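(* Let $G$ be a 2-connected plane graph with $k$ large faces. If $R$ is a minimal cut of $G$, then the induced subgraph $G[R]$ has at most $k$ connected components.
   Context: In a 2-connected plane graph every face is bounded by a cycle; a large face is a face whose bounding cycle has length at least 4. A cut of a connected graph $G=(V,E)$ is a set $R\subset V$ with $G-R$ disconnected; it is minimal if $G-T$ is connected for every proper subset $T\subset R$.
   Formalization: The number k of large faces is assumed to be at least 1; for k = 0 the claim fails, e.g. for the triangular bipyramid, whose three equatorial vertices form a minimal cut inducing one component. *)

theory Defs
  imports "HOL-Analysis.Analysis"
begin

section \<open>Undirected graphs\<close>

text \<open>
  Edges are two-element sets of vertices. Connected graphs are nonempty.
\<close>

record 'a ugraph =
  gverts :: "'a set"
  gedges :: "'a set set"

definition induced :: "'a ugraph \<Rightarrow> 'a set \<Rightarrow> 'a ugraph" where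
  "induced G S =
     \<lparr>gverts = gverts G \<inter> S, gedges = {e \<in> gedges G. e \<subseteq> gverts G \<inter> S}\<rparr>"

definition del_verts :: "'a ugraph \<Rightarrow> 'a set \<Rightarrow> 'a ugraph" where
  "del_verts G S = induced G (gverts G - S)"

definition reach :: "'a ugraph \<Rightarrow> 'a rel" where
  "reach G = {(u, v). u \<in> gverts G \<and> v \<in> gverts G \<and>
                      (u, v) \<in> {(x, y). {x, y} \<in> gedges G}\<^sup>*}"

definition graph_connected :: "'a ugraph \<Rightarrow> bool" where
  "graph_connected G \<longleftrightarrow>
     gverts G \<noteq> {} \<and> (\<forall>u \<in> gverts G. \<forall>v \<in> gverts G. (u, v) \<in> reach G)"

definition graph_components :: "'a ugraph \<Rightarrow> 'a set set" where
  "graph_components G = gverts G // reach G"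

definition k_vertex_connected :: "nat \<Rightarrow> 'a ugraph \<Rightarrow> bool" where
  "k_vertex_connected k G \<longleftrightarrow>
     finite (gverts G) \<and> card (gverts G) > k \<and>
     (\<forall>X \<subseteq> gverts G. card X < k \<longrightarrow> graph_connected (del_verts G X))"

text \<open>
  A cut is a proper subset of the vertices, so the empty graph never arises as
  what is left after deleting a cut.
\<close>

definition is_cut :: "'a ugraph \<Rightarrow> 'a set \<Rightarrow> bool" where
  "is_cut G R \<longleftrightarrow> R \<subset> gverts G \<and> \<not> graph_connected (del_verts G R)"

definition minimal_cut :: "'a ugraph \<Rightarrow> 'a set \<Rightarrow> bool" where
  "minimal_cut G R \<longleftrightarrow>
     is_cut G R \<and> (\<forall>T. T \<subset> R \<longrightarrow> graph_connected (del_verts G T))"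

definition cycle_edges :: "'a list \<Rightarrow> 'a set set" where
  "cycle_edges vs = {{vs ! i, vs ! (Suc i mod length vs)} | i. i < length vs}"

text \<open>A cycle is given by its cyclic list of vertices; its length is the length of the list.\<close>

definition graph_cycle :: "'a ugraph \<Rightarrow> 'a list \<Rightarrow> bool" where
  "graph_cycle G vs \<longleftrightarrow>
     length vs \<ge> 3 \<and> distinct vs \<and> set vs \<subseteq> gverts G \<and> cycle_edges vs \<subseteq> gedges G"


section \<open>Plane graphs\<close>

text \<open>
  A (finite, simple) plane graph consists of a finite set \<open>V\<close> of points of the plane and a
  finite set \<open>E\<close> of arcs, taken as point sets. Each arc joins two vertices and has no vertex
  in its interior, so the ends of \<open>e\<close> are the points of \<open>e \<inter> V\<close>. Distinct arcs
  meet at most in vertices and have different pairs of ends.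
\<close>

definition plane_graph :: "complex set \<Rightarrow> complex set set \<Rightarrow> bool" where
  "plane_graph V E \<longleftrightarrow>
     finite V \<and> finite E \<and>
     (\<forall>e \<in> E. \<exists>g. arc g \<and> path_image g = e \<and> e \<inter> V = {pathstart g, pathfinish g}) \<and>
     (\<forall>e \<in> E. \<forall>e' \<in> E. e \<noteq> e' \<longrightarrow> e \<inter> e' \<subseteq> V \<and> e \<inter> V \<noteq> e' \<inter> V)"

definition graph_of :: "complex set \<Rightarrow> complex set set \<Rightarrow> complex ugraph" where
  "graph_of V E = \<lparr>gverts = V, gedges = (\<lambda>e. e \<inter> V) ` E\<rparr>"

definition faces :: "complex set \<Rightarrow> complex set set \<Rightarrow> complex set set" where
  "faces V E = components (- (V \<union> \<Union>E))"

definition bounds_face ::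
    "complex set \<Rightarrow> complex set set \<Rightarrow> complex list \<Rightarrow> complex set \<Rightarrow> bool" where
  "bounds_face V E vs F \<longleftrightarrow>
     graph_cycle (graph_of V E) vs \<and>
     frontier F = \<Union>{e \<in> E. e \<inter> V \<in> cycle_edges vs}"

definition large_faces :: "complex set \<Rightarrow> complex set set \<Rightarrow> complex set set" where
  "large_faces V E = {F \<in> faces V E. \<exists>vs. bounds_face V E vs F \<and> length vs \<ge> 4}"

end

theory Submission
  imports Defs "HOL-Complex_Analysis.Winding_Numbers"
begin

text \<open>
  Let \<open>A\<close> and \<open>K\<close> be two components of \<open>G - R\<close>; by minimality every vertex of \<open>R\<close> has
  neighbours in both. For a set \<open>I\<close> of components of \<open>G[R]\<close> consider the edges between \<open>A\<close>
  and \<open>\<Union>I\<close>, and the set \<open>\<Psi> I\<close> of faces whose boundary contains an odd number of them. A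
  triangular face never belongs to \<open>\<Psi> I\<close>. In a plane graph, an edge set that meets all face
  boundaries but one evenly is a cut, i.e. consists of the edges on which some 0-1 function of
  the vertices changes. Here that function is constant on \<open>A\<close> and on \<open>K \<union> R\<close>, so one edge
  between \<open>A\<close> and \<open>R\<close> outside the cut makes the cut empty. So if \<open>I\<close> avoids a fixed
  component and a fixed large face is ignored, \<open>\<Psi>\<close> embeds the subsets of an \<open>(m - 1)\<close>-element
  set into those of a \<open>(k - 1)\<close>-element set, where \<open>m\<close> is the number of components of \<open>G[R]\<close>.

  That faces are bounded by cycles, and that the edge sets above are cuts, is shown together
  by attaching ears: an ear splits one face into two, by the theta curve form of the Jordan
  curve theorem.
\<close>

section \<open>Theta curves\<close>

lemma connected_subset_if_disjoint_frontier:
  "connected S \<Longrightarrow> S \<inter> frontier T = {} \<Longrightarrow> S \<inter> T \<noteq> {} \<Longrightarrow> S \<subseteq> T"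
  using connected_Int_frontier[of S T] by blast

section \<open>Jordan curves and their two sides\<close>

definition jordan_curve :: "complex set \<Rightarrow> bool" where
  "jordan_curve C \<longleftrightarrow> (\<exists>g. simple_path g \<and> pathfinish g = pathstart g \<and> path_image g = C)"

lemma jordan_curve_inside_outside:
  assumes "jordan_curve C"
  shows "inside C \<noteq> {}" "open (inside C)" "connected (inside C)"
    "outside C \<noteq> {}" "open (outside C)" "connected (outside C)"
    "inside C \<inter> outside C = {}" "inside C \<union> outside C = - C"
    "frontier (inside C) = C" "frontier (outside C) = C"
  using assms Jordan_inside_outside unfolding jordan_curve_def by metis+

lemma components_jordan_curve:
  assumes "jordan_curve C"
  shows "components (- C) = {inside C, outside C}"
proof (rule components_open_unique)
  show "pairwise disjnt {inside C, outside C}"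
    using jordan_curve_inside_outside(7)[OF assms] by (simp add: pairwise_insert disjnt_def Int_commute)
qed (use jordan_curve_inside_outside[OF assms] in auto)

lemma jordan_curve_arcs:
  assumes "arc p" "arc q" "pathstart p = a" "pathfinish p = b" "pathstart q = a" "pathfinish q = b"
    "path_image p \<inter> path_image q = {a, b}"
  shows "jordan_curve (path_image p \<union> path_image q)"
  unfolding jordan_curve_def
proof (intro exI conjI)
  show "simple_path (p +++ reversepath q)"
    by (rule simple_path_join_loop) (use assms in \<open>auto simp: arc_reversepath\<close>)
qed (use assms in \<open>auto simp: path_image_join\<close>)

text \<open>An open set misses its frontier, so \<open>F\<close> lies in one component of the
  complement of \<open>C\<close>; that component misses the frontier of \<open>F\<close>, so it
  cannot leave \<open>F\<close>. A face of a large graph can thus be treated as a side of its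
  bounding cycle alone.\<close>

lemma component_eq_if_frontier_jordan_curve:
  assumes "jordan_curve C" "open F" "connected F" "F \<noteq> {}" "frontier F = C"
  shows "F \<in> components (- C)"
proof -
  have disj: "F \<inter> C = {}"
    using assms(2,5) frontier_disjoint_eq by blast
  obtain D where D: "D \<in> components (- C)" "F \<inter> D \<noteq> {}"
    using disj assms(4) by (metis Compl_iff Union_components disjoint_iff equals0I UnionE)
  have "F \<subseteq> D"
    using components_maximal[OF D(1) assms(3)] disj D(2) by blast
  moreover have "D \<subseteq> F"
  proof (rule connected_subset_if_disjoint_frontier)
    show "connected D" using D(1) in_components_connected by blast
    show "D \<inter> frontier F = {}" using assms(5) in_components_subset[OF D(1)] by blast
  qed (use D(2) in blast)
  ultimately show ?thesis using D(1) by simp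
qed

lemma closure_inside_jordan_curve:
  "jordan_curve C \<Longrightarrow> closure (inside C) = inside C \<union> C"
  using closure_Un_frontier[of "inside C"] jordan_curve_inside_outside(9) by metis

text \<open>If neither arc lay inside the cycle formed by the other two, then around a point inside
  \<open>p \<union> q\<close> the curves \<open>p - r\<close> and \<open>q - r\<close> would have winding number 0, hence so would
  their difference \<open>p - q\<close>.\<close>

lemma theta_outside_cases:
  fixes p q r :: "real \<Rightarrow> complex"
  assumes arcs: "arc p" "arc q" "arc r"
    and ends: "pathstart p = a" "pathfinish p = b" "pathstart q = a" "pathfinish q = b"
      "pathstart r = a" "pathfinish r = b"
    and int: "path_image p \<inter> path_image q = {a, b}" "path_image p \<inter> path_image r = {a, b}"
      "path_image q \<inter> path_image r = {a, b}"
    and out: "path_image r - {a, b} \<subseteq> outside (path_image p \<union> path_image q)"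
  shows "path_image q \<inter> inside (path_image p \<union> path_image r) \<noteq> {} \<or>
    path_image p \<inter> inside (path_image q \<union> path_image r) \<noteq> {}"
proof (rule ccontr)
  let ?P = "path_image p" and ?Q = "path_image q" and ?R = "path_image r"
  assume "\<not> ?thesis"
  then have no: "?Q \<inter> inside (?P \<union> ?R) = {}" "?P \<inter> inside (?Q \<union> ?R) = {}" by auto
  have jPQ: "jordan_curve (?P \<union> ?Q)" and jPR: "jordan_curve (?P \<union> ?R)"
    and jQR: "jordan_curve (?Q \<union> ?R)"
    using jordan_curve_arcs arcs ends int by metis+
  obtain z where z: "z \<in> inside (?P \<union> ?Q)"
    using jordan_curve_inside_outside(1)[OF jPQ] by blast
  have iR: "inside (?P \<union> ?Q) \<inter> ?R = {}"
    using out jordan_curve_inside_outside(7,8)[OF jPQ] int(1) by blast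
  have iPQ: "inside (?P \<union> ?Q) \<inter> (?P \<union> ?Q) = {}"
    using jordan_curve_inside_outside(8)[OF jPQ] by blast
  have ne: "path_image g - {a, b} \<noteq> {}" if "arc g" "pathstart g = a" "pathfinish g = b" for g
    using nonempty_simple_path_endless[of g] that arc_imp_simple_path by auto
  \<comment> \<open>If \<open>z\<close> lay inside, then so would all of
    \<open>inside (?P \<union> ?Q)\<close>, which is connected and misses the curve
    \<open>T \<union> ?R\<close>. Passing to closures puts the points of \<open>S\<close> off that
    curve inside it, against \<open>n\<close>.\<close>
  have zout: "z \<notin> inside (T \<union> ?R)"
    if T: "T \<subseteq> ?P \<union> ?Q" and S: "S \<subseteq> ?P \<union> ?Q" "S - (T \<union> ?R) \<noteq> {}"
      and j: "jordan_curve (T \<union> ?R)" and n: "S \<inter> inside (T \<union> ?R) = {}" for S T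
  proof
    assume "z \<in> inside (T \<union> ?R)"
    then have "inside (?P \<union> ?Q) \<subseteq> inside (T \<union> ?R)"
      using connected_subset_if_disjoint_frontier[of "inside (?P \<union> ?Q)" "inside (T \<union> ?R)"]
        jordan_curve_inside_outside(9)[OF j] jordan_curve_inside_outside(3)[OF jPQ] iR iPQ T z
      by blast
    from closure_mono[OF this] have "S \<subseteq> inside (T \<union> ?R) \<union> (T \<union> ?R)"
      using closure_inside_jordan_curve[OF jPQ] closure_inside_jordan_curve[OF j] S(1) by auto
    with n S(2) show False by blast
  qed
  have "?Q - (?P \<union> ?R) \<noteq> {}" "?P - (?Q \<union> ?R) \<noteq> {}"
    using ne[of q] ne[of p] arcs ends int by blast+
  then have "z \<notin> inside (?P \<union> ?R)" "z \<notin> inside (?Q \<union> ?R)"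
    using zout[of ?P ?Q] zout[of ?Q ?P] jPR jQR no by auto
  moreover have zn: "z \<notin> ?P" "z \<notin> ?Q" "z \<notin> ?R" using z iR iPQ by blast+
  ultimately have "z \<in> outside (?P \<union> ?R)" "z \<in> outside (?Q \<union> ?R)"
    using jordan_curve_inside_outside(8)[OF jPR] jordan_curve_inside_outside(8)[OF jQR] by blast+
  then have "winding_number (p +++ reversepath r) z = 0" "winding_number (q +++ reversepath r) z = 0"
    using arcs ends by (auto intro!: winding_number_zero_in_outside simp: path_image_join arc_imp_path)
  then have "winding_number p z = winding_number q z"
    using arcs ends zn by (auto simp: winding_number_join winding_number_reversepath arc_imp_path)
  then have "winding_number (p +++ reversepath q) z = 0"
    using arcs ends zn by (auto simp: winding_number_join winding_number_reversepath arc_imp_path)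
  moreover have "norm (winding_number (p +++ reversepath q) z) = 1"
  proof (rule simple_closed_path_norm_winding_number_inside)
    show "simple_path (p +++ reversepath q)"
      by (rule simple_path_join_loop) (use arcs ends int in \<open>auto simp: arc_reversepath\<close>)
  qed (use z ends in \<open>auto simp: path_image_join\<close>)
  ultimately show False by simp
qed

text \<open>Since \<open>q\<close> runs inside the cycle of \<open>p\<close> and \<open>r\<close>,
  it splits that inside into the insides of \<open>p \<union> q\<close> and
  \<open>q \<union> r\<close>. Complementing this decomposition describes the outside of
  \<open>p \<union> q\<close>.\<close>

lemma theta_split_outside:
  fixes p q r :: "real \<Rightarrow> complex"
  assumes arcs: "arc p" "arc q" "arc r"
    and ends: "pathstart p = a" "pathfinish p = b" "pathstart q = a" "pathfinish q = b"
      "pathstart r = a" "pathfinish r = b"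
    and int: "path_image p \<inter> path_image q = {a, b}" "path_image p \<inter> path_image r = {a, b}"
      "path_image q \<inter> path_image r = {a, b}"
    and out: "path_image r - {a, b} \<subseteq> outside (path_image p \<union> path_image q)"
    and ins: "path_image q \<inter> inside (path_image p \<union> path_image r) \<noteq> {}"
  shows "outside (path_image p \<union> path_image r) \<inter> inside (path_image q \<union> path_image r) = {}"
    "outside (path_image p \<union> path_image r) \<union> inside (path_image q \<union> path_image r) =
     outside (path_image p \<union> path_image q) - path_image r"
proof -
  let ?P = "path_image p" and ?Q = "path_image q" and ?R = "path_image r"
  have jPQ: "jordan_curve (?P \<union> ?Q)" and jPR: "jordan_curve (?P \<union> ?R)"
    and jQR: "jordan_curve (?Q \<union> ?R)"
    using jordan_curve_arcs arcs ends int by metis+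
  have "a \<noteq> b" using arcs ends arc_distinct_ends by metis
  have split: "inside (?P \<union> ?Q) \<inter> inside (?R \<union> ?Q) = {}"
    "inside (?P \<union> ?Q) \<union> inside (?R \<union> ?Q) \<union> (?Q - {a, b}) = inside (?P \<union> ?R)"
    using split_inside_simple_closed_curve[OF arc_imp_simple_path[OF arcs(1)] ends(1,2)
        arc_imp_simple_path[OF arcs(3)] ends(5,6) arc_imp_simple_path[OF arcs(2)] ends(3,4)
        \<open>a \<noteq> b\<close> int(2,1) _ ins] int(3) by (simp_all add: Int_commute)
  note j = jordan_curve_inside_outside(7,8)[OF jPQ] jordan_curve_inside_outside(7,8)[OF jPR]
    jordan_curve_inside_outside(7,8)[OF jQR]
  have eq: "?R \<union> ?Q = ?Q \<union> ?R" by blast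
  note s = split[unfolded eq]
  show "outside (?P \<union> ?R) \<inter> inside (?Q \<union> ?R) = {}" using s j by blast
  have ab: "a \<in> ?P" "b \<in> ?P" using int by auto
  show "outside (?P \<union> ?R) \<union> inside (?Q \<union> ?R) = outside (?P \<union> ?Q) - ?R" (is "?L = ?O")
  proof (rule set_eqI)
    fix x
    have "x \<in> ?Q \<Longrightarrow> x \<notin> ?P \<Longrightarrow> x \<in> inside (?P \<union> ?R)" using s(2) ab by blast
    moreover have "x \<in> inside (?P \<union> ?Q) \<Longrightarrow> x \<in> inside (?P \<union> ?R)"
      "x \<in> inside (?Q \<union> ?R) \<Longrightarrow> x \<in> inside (?P \<union> ?R)" using s(2) by blast+
    moreover have "x \<in> inside (?P \<union> ?R) \<Longrightarrow> x \<in> inside (?P \<union> ?Q) \<or> x \<in> inside (?Q \<union> ?R) \<or> x \<in> ?Q"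
      using s(2) by blast
    moreover have "x \<in> inside (?P \<union> ?Q) \<Longrightarrow> x \<notin> inside (?Q \<union> ?R)" using s(1) by blast
    moreover have "x \<in> outside (?P \<union> ?Q) \<longleftrightarrow> x \<notin> ?P \<and> x \<notin> ?Q \<and> x \<notin> inside (?P \<union> ?Q)"
      "x \<in> inside (?P \<union> ?Q) \<Longrightarrow> x \<notin> ?P \<and> x \<notin> ?Q"
      "x \<in> outside (?P \<union> ?R) \<longleftrightarrow> x \<notin> ?P \<and> x \<notin> ?R \<and> x \<notin> inside (?P \<union> ?R)"
      "x \<in> inside (?P \<union> ?R) \<Longrightarrow> x \<notin> ?P \<and> x \<notin> ?R"
      "x \<in> inside (?Q \<union> ?R) \<Longrightarrow> x \<notin> ?Q \<and> x \<notin> ?R"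
      using j by blast+
    ultimately show "x \<in> ?L \<longleftrightarrow> x \<in> ?O" by blast
  qed
qed

text \<open>If \<open>F\<close> is the inside of the cycle, \<open>r\<close> is a crossing arc and
  the splitting theorem for insides applies directly. If \<open>F\<close> is the outside, one of
  \<open>p\<close> and \<open>q\<close> meets the inside of the cycle formed by the other and
  \<open>r\<close>, which reduces to the preceding lemma.\<close>

lemma theta_split:
  fixes p q r :: "real \<Rightarrow> complex"
  assumes arcs: "arc p" "arc q" "arc r"
    and ends: "pathstart p = a" "pathfinish p = b" "pathstart q = a" "pathfinish q = b"
      "pathstart r = a" "pathfinish r = b"
    and int: "path_image p \<inter> path_image q = {a, b}" "path_image p \<inter> path_image r = {a, b}"
      "path_image q \<inter> path_image r = {a, b}"
    and F: "F \<in> components (- (path_image p \<union> path_image q))" "path_image r - {a, b} \<subseteq> F"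
  obtains F1 F2 where "F1 \<in> components (- (path_image p \<union> path_image r))"
    "F2 \<in> components (- (path_image q \<union> path_image r))"
    "F1 \<inter> F2 = {}" "F1 \<union> F2 = F - path_image r"
proof -
  let ?P = "path_image p" and ?Q = "path_image q" and ?R = "path_image r"
  have jPQ: "jordan_curve (?P \<union> ?Q)" and jPR: "jordan_curve (?P \<union> ?R)"
    and jQR: "jordan_curve (?Q \<union> ?R)"
    using jordan_curve_arcs arcs ends int by metis+
  note comp = components_jordan_curve[OF jPR] components_jordan_curve[OF jQR]
  have ne: "?R - {a, b} \<noteq> {}"
    using nonempty_simple_path_endless[of r] arcs ends arc_imp_simple_path by auto
  have "a \<noteq> b" using arcs ends arc_distinct_ends by metis
  consider "F = inside (?P \<union> ?Q)" | "F = outside (?P \<union> ?Q)"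
    using F(1) components_jordan_curve[OF jPQ] by auto
  then show thesis
  proof cases
    case 1
    have s: "inside (?P \<union> ?R) \<inter> inside (?Q \<union> ?R) = {}"
      "inside (?P \<union> ?R) \<union> inside (?Q \<union> ?R) \<union> (?R - {a, b}) = inside (?P \<union> ?Q)"
      using split_inside_simple_closed_curve[OF arc_imp_simple_path[OF arcs(1)] ends(1,2)
          arc_imp_simple_path[OF arcs(2)] ends(3,4) arc_imp_simple_path[OF arcs(3)] ends(5,6)
          \<open>a \<noteq> b\<close> int(1,2,3)] ne F(2)
      unfolding 1 by blast+
    have "inside (?P \<union> ?R) \<inter> ?R = {}" "inside (?Q \<union> ?R) \<inter> ?R = {}"
      using jordan_curve_inside_outside(8)[OF jPR] jordan_curve_inside_outside(8)[OF jQR] by blast+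
    moreover have "inside (?P \<union> ?Q) \<inter> {a, b} = {}"
      using jordan_curve_inside_outside(8)[OF jPQ] int by blast
    ultimately have "inside (?P \<union> ?R) \<union> inside (?Q \<union> ?R) = F - ?R"
      using s(2) unfolding 1 by blast
    with s(1) that comp show thesis by blast
  next
    case 2
    then have out: "?R - {a, b} \<subseteq> outside (?P \<union> ?Q)" "?R - {a, b} \<subseteq> outside (?Q \<union> ?P)"
      using F(2) by (auto simp: Un_commute)
    from theta_outside_cases[OF arcs ends int out(1)] show thesis
    proof
      assume "?Q \<inter> inside (?P \<union> ?R) \<noteq> {}"
      from theta_split_outside[OF arcs ends int out(1) this] show thesis
        using that comp 2 by (metis insertI1 insertI2)
    next
      assume "?P \<inter> inside (?Q \<union> ?R) \<noteq> {}"
      \<comment> \<open>With \<open>p\<close> and \<open>q\<close> exchanged, the unbounded new face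
        is the one bounded by \<open>q\<close> and \<open>r\<close>.\<close>
      from theta_split_outside[OF arcs(2,1,3) ends(3,4,1,2,5,6) _ int(3,2) out(2) this] int(1)
      show thesis
        using that[of "inside (?P \<union> ?R)" "outside (?Q \<union> ?R)"] comp 2
        by (auto simp: Un_commute Int_commute)
    qed
  qed
qed

section \<open>Walks and drawings\<close>

fun path_edges :: "'a list \<Rightarrow> 'a set set" where
  "path_edges (x # y # zs) = insert {x, y} (path_edges (y # zs))"
| "path_edges _ = {}"

text \<open>A set of edges is encoded as a relation \<open>d\<close> on vertices. The value is its
  pairing with the walk over GF(2), repeated edges being counted repeatedly, so it is additive both
  in the walk and in \<open>d\<close>.\<close>

fun odd_walk :: "('a \<Rightarrow> 'a \<Rightarrow> bool) \<Rightarrow> 'a list \<Rightarrow> bool" where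
  "odd_walk d (x # y # zs) \<longleftrightarrow> d x y \<noteq> odd_walk d (y # zs)"
| "odd_walk d _ \<longleftrightarrow> False"

text \<open>Returning to the first vertex lets the concatenation and reversal laws of walks serve
  cycles as well.\<close>

abbreviation closed_walk :: "'a list \<Rightarrow> 'a list" where
  "closed_walk vs \<equiv> vs @ [hd vs]"

lemma path_edges_append: "path_edges (xs @ y # zs) = path_edges (xs @ [y]) \<union> path_edges (y # zs)"
  by (induction xs rule: path_edges.induct) auto

lemma path_edges_rev: "path_edges (rev xs) = path_edges xs"
proof (induction xs rule: path_edges.induct)
  case (1 x y zs)
  have "path_edges (rev (x # y # zs)) = path_edges (rev zs @ [y]) \<union> path_edges [y, x]"
    using path_edges_append[of "rev zs" y "[x]"] by simp
  with 1 show ?case by (auto simp: insert_commute)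
qed auto

lemma Union_path_edges: "length xs \<ge> 2 \<Longrightarrow> \<Union>(path_edges xs) = set xs"
proof (induction xs rule: path_edges.induct)
  case (1 x y zs)
  then show ?case by (cases zs) auto
qed auto

lemma path_edges_subset: "e \<in> path_edges xs \<Longrightarrow> e \<subseteq> set xs"
  by (induction xs rule: path_edges.induct) auto

lemma path_edgesE:
  assumes "e \<in> path_edges xs" "distinct xs"
  obtains x y where "e = {x, y}" "x \<noteq> y" "x \<in> set xs" "y \<in> set xs"
  using assms by (induction xs rule: path_edges.induct) auto

text \<open>If there are inner vertices, the only edge at \<open>u\<close> leads to the first of
  them, which differs from \<open>w\<close>.\<close>

lemma ends_in_path_edges_iff:
  assumes "distinct (u # q @ [w])"
  shows "{u, w} \<in> path_edges (u # q @ [w]) \<longleftrightarrow> q = []"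
proof (cases q)
  case (Cons x q')
  then show ?thesis using assms path_edges_subset[of "{u, w}" "x # q' @ [w]"]
    by (auto simp: doubleton_eq_iff)
qed simp

lemma odd_walk_append: "odd_walk d (xs @ y # zs) \<longleftrightarrow> odd_walk d (xs @ [y]) \<noteq> odd_walk d (y # zs)"
  by (induction d xs rule: odd_walk.induct) auto

lemma odd_walk_rev:
  assumes "symp d"
  shows "odd_walk d (rev xs) = odd_walk d xs"
  using assms
proof (induction d xs rule: odd_walk.induct)
  case (1 d x y zs)
  have "odd_walk d (rev (x # y # zs)) \<longleftrightarrow> odd_walk d (rev zs @ [y]) \<noteq> odd_walk d [y, x]"
    using odd_walk_append[of d "rev zs" y "[x]"] by simp
  with 1 show ?case by (auto dest: sympD)
qed auto

lemma odd_walk_xor: "odd_walk (\<lambda>x y. d x y \<noteq> d' x y) xs \<longleftrightarrow> odd_walk d xs \<noteq> odd_walk d' xs"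
  by (induction xs rule: path_edges.induct) auto

text \<open>The changes of \<open>f\<close> along the walk telescope modulo 2.\<close>

lemma odd_walk_potential:
  fixes f :: "'a \<Rightarrow> bool"
  assumes "\<And>x y. {x, y} \<in> path_edges xs \<Longrightarrow> d x y \<longleftrightarrow> f x \<noteq> f y" "xs \<noteq> []"
  shows "odd_walk d xs \<longleftrightarrow> f (hd xs) \<noteq> f (last xs)"
  using assms
proof (induction xs rule: path_edges.induct)
  case (1 x y zs)
  have "odd_walk d (x # y # zs) \<longleftrightarrow> (f x \<noteq> f y) \<noteq> (f y \<noteq> f (last (y # zs)))"
    using 1 by simp
  also have "\<dots> \<longleftrightarrow> f x \<noteq> f (last (y # zs))" by argo
  finally show ?case by simp
qed auto

text \<open>Values are propagated along the walk from the prescribed one at \<open>x\<close>;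
  distinctness ensures that none is assigned twice. Keeping \<open>f0\<close> off the tail is what
  allows a potential to be extended over an ear.\<close>

lemma exists_potential:
  fixes d :: "'a \<Rightarrow> 'a \<Rightarrow> bool" and f0 :: "'a \<Rightarrow> bool"
  assumes "symp d" "distinct (x # xs)"
  shows "\<exists>f. (\<forall>z. z \<notin> set xs \<longrightarrow> f z = f0 z) \<and>
    (\<forall>a b. {a, b} \<in> path_edges (x # xs) \<longrightarrow> (d a b \<longleftrightarrow> f a \<noteq> f b))"
  using assms(2)
proof (induction xs arbitrary: x f0)
  case Nil
  then show ?case by auto
next
  case (Cons y ys)
  \<comment> \<open>The value at \<open>y\<close> is forced by the one at \<open>x\<close>; the
    corrected function is the prescription for the rest of the walk.\<close>
  define g where "g = f0(y := (d x y \<noteq> f0 x))"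
  have "distinct (y # ys)" using Cons.prems by simp
  from Cons.IH[OF this, of g] obtain f where f: "\<forall>z. z \<notin> set ys \<longrightarrow> f z = g z"
    "\<forall>a b. {a, b} \<in> path_edges (y # ys) \<longrightarrow> (d a b \<longleftrightarrow> f a \<noteq> f b)" by (elim exE conjE)
  have xy: "f y = (d x y \<noteq> f0 x)" "f x = f0 x"
    using f(1)[rule_format, of y] f(1)[rule_format, of x] Cons.prems by (auto simp: g_def)
  have "d a b \<longleftrightarrow> f a \<noteq> f b" if "{a, b} \<in> path_edges (x # y # ys)" for a b
  proof (cases "{a, b} = {x, y}")
    case True
    moreover have "d y x = d x y" using assms(1) by (auto dest: sympD)
    ultimately show ?thesis using xy by (auto simp: doubleton_eq_iff)
  next
    case False
    then show ?thesis using that f(2)[rule_format, of a b] by simp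
  qed
  moreover have "f z = f0 z" if "z \<notin> set (y # ys)" for z
    using that f(1)[rule_format, of z] by (simp add: g_def)
  ultimately show ?case by (intro exI[of _ f]) blast
qed

lemma path_edges_rotate:
  "path_edges (closed_walk (xs @ u # t)) = path_edges (closed_walk (u # t @ xs))"
proof (cases xs)
  case (Cons x xs')
  show ?thesis
    using path_edges_append[of "x # xs'" u "t @ [x]"] path_edges_append[of "u # t" x "xs' @ [u]"] Cons
    by (auto simp del: path_edges.simps)
qed simp

lemma odd_walk_rotate:
  "odd_walk d (closed_walk (xs @ u # t)) = odd_walk d (closed_walk (u # t @ xs))"
proof (cases xs)
  case (Cons x xs')
  show ?thesis
    using odd_walk_append[of d "x # xs'" u "t @ [x]"] odd_walk_append[of d "u # t" x "xs' @ [u]"] Cons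
    by (auto simp del: odd_walk.simps)
qed simp

lemma path_edges_conv_nth:
  "path_edges xs = {{xs ! i, xs ! Suc i} | i. Suc i < length xs}"
proof (induction xs rule: path_edges.induct)
  case (1 x y zs)
  have "{{(x # y # zs) ! i, (x # y # zs) ! Suc i} | i. Suc i < length (x # y # zs)} =
    insert {x, y} {{(y # zs) ! i, (y # zs) ! Suc i} | i. Suc i < length (y # zs)}" (is "?A = insert _ ?B")
  proof (rule set_eqI, rule iffI)
    fix e assume "e \<in> ?A"
    then obtain i where "e = {(x # y # zs) ! i, (x # y # zs) ! Suc i}" "Suc i < length (x # y # zs)" by blast
    then show "e \<in> insert {x, y} ?B" by (cases i) auto
  next
    fix e assume "e \<in> insert {x, y} ?B"
    then consider "e = {x, y}" | i where "e = {(y # zs) ! i, (y # zs) ! Suc i}" "Suc i < length (y # zs)" by blast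
    then show "e \<in> ?A"
    proof cases
      case 1 then show ?thesis by (intro CollectI exI[of _ 0]) auto
    next
      case 2 then show ?thesis by (intro CollectI exI[of _ "Suc i"]) auto
    qed
  qed
  with 1 show ?case by simp
qed auto

lemma cycle_edges_eq_path_edges:
  assumes "vs \<noteq> []"
  shows "cycle_edges vs = path_edges (closed_walk vs)"
proof -
  have "closed_walk vs ! Suc i = vs ! (Suc i mod length vs)" if "i < length vs" for i
    using that assms by (cases "Suc i = length vs") (auto simp: nth_append hd_conv_nth)
  then show ?thesis
    unfolding cycle_edges_def path_edges_conv_nth by (auto simp: nth_append)
qed

text \<open>The walk is built backwards from \<open>z\<close>: a start vertex in \<open>T\<close>
  discards everything after it, a vertex already on the walk shortcuts to its occurrence, and any
  other vertex is put in front.\<close>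

lemma exists_first_hitting_walk:
  assumes "(v, z) \<in> {(x, y). {x, y} \<in> A}\<^sup>*" "z \<in> T"
  obtains xs w where "distinct (xs @ [w])" "hd (xs @ [w]) = v" "set xs \<inter> T = {}" "w \<in> T"
    "path_edges (xs @ [w]) \<subseteq> A"
  using assms
proof (induction arbitrary: thesis rule: converse_rtrancl_induct)
  case base
  then show ?case using base(1)[of "[]" z] by simp
next
  case (step v v')
  obtain xs w where xs: "distinct (xs @ [w])" "hd (xs @ [w]) = v'" "set xs \<inter> T = {}" "w \<in> T"
    "path_edges (xs @ [w]) \<subseteq> A" using step by blast
  consider "v \<in> T" | "v \<notin> T" "v \<in> set xs" | "v \<notin> T" "v \<notin> set xs" by blast
  then show ?case
  proof cases
    case 1 then show ?thesis using step.prems(1)[of "[]" v] by simp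
  next
    case 2
    then obtain s t where "xs = s @ v # t" by (meson split_list)
    then show ?thesis using step.prems(1)[of "v # t" w] xs path_edges_append[of s v "t @ [w]"] by auto
  next
    case 3
    have "path_edges ((v # xs) @ [w]) \<subseteq> A"
      using xs step.hyps(1) by (cases xs) auto
    then show ?thesis using step.prems(1)[of "v # xs" w] xs 3 by auto
  qed
qed

section \<open>Walks as point sets of a plane graph\<close>

locale plane_drawing =
  fixes V :: "complex set" and E :: "complex set set"
  assumes plane: "plane_graph V E"
begin

abbreviation ends :: "complex set set \<Rightarrow> complex set set" where
  "ends X \<equiv> (\<lambda>e. e \<inter> V) ` X"

text \<open>Walks record only pairs of ends. As distinct arcs of \<open>E\<close> have distinct
  pairs of ends, each such pair determines its arc, and the point set can be recovered.\<close>

definition drawing :: "complex list \<Rightarrow> complex set" where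
  "drawing xs = \<Union>{e \<in> E. e \<inter> V \<in> path_edges xs}"

lemmas plane_unfolded = plane[unfolded plane_graph_def]

lemma finite_VE: "finite V" "finite E"
  using plane_unfolded[THEN conjunct1] plane_unfolded[THEN conjunct2, THEN conjunct1] by simp_all

lemma edge_arc_ex:
  assumes "e \<in> E"
  obtains g where "arc g" "path_image g = e" "e \<inter> V = {pathstart g, pathfinish g}"
  using bspec[OF plane_unfolded[THEN conjunct2, THEN conjunct2, THEN conjunct1] assms] by blast

lemma edge_arc:
  assumes "e \<in> E" "e \<inter> V = {x, y}"
  obtains g where "arc g" "path_image g = e" "pathstart g = x" "pathfinish g = y"
proof -
  obtain g where g: "arc g" "path_image g = e" "e \<inter> V = {pathstart g, pathfinish g}"
    using edge_arc_ex[OF assms(1)] by metis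
  then have "{pathstart g, pathfinish g} = {x, y}" using assms(2) by simp
  then consider "pathstart g = x" "pathfinish g = y" | "pathstart g = y" "pathfinish g = x"
    unfolding doubleton_eq_iff by blast
  then show thesis
  proof cases
    case 1
    then show thesis by (rule that[OF g(1,2)])
  next
    case 2
    then show thesis using that[of "reversepath g"] g(1,2) by (simp add: arc_reversepath)
  qed
qed

lemma edge_ends:
  assumes "e \<in> E"
  obtains x y where "e \<inter> V = {x, y}" "x \<noteq> y"
  using edge_arc_ex[OF assms] arc_distinct_ends by metis

lemma edge_closed:
  assumes "e \<in> E"
  shows "closed e"
  using edge_arc_ex[OF assms] arc_imp_path closed_path_image by metis

lemma edges_Int: "e \<in> E \<Longrightarrow> e' \<in> E \<Longrightarrow> e \<noteq> e' \<Longrightarrow> e \<inter> e' \<subseteq> V"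
  using plane_unfolded[THEN conjunct2, THEN conjunct2, THEN conjunct2] by blast

lemma edge_eqI: "e \<in> E \<Longrightarrow> e' \<in> E \<Longrightarrow> e \<inter> V = e' \<inter> V \<Longrightarrow> e = e'"
  using plane_unfolded[THEN conjunct2, THEN conjunct2, THEN conjunct2] by blast

lemma drawing_Un:
  "path_edges xs = path_edges ys \<union> path_edges zs \<Longrightarrow> drawing xs = drawing ys \<union> drawing zs"
  by (auto simp: drawing_def)

lemma drawing_Int_V:
  assumes "path_edges xs \<subseteq> ends E" "length xs \<ge> 2"
  shows "drawing xs \<inter> V = set xs"
proof -
  have "drawing xs \<inter> V = \<Union>(path_edges xs)"
  proof
    show "\<Union>(path_edges xs) \<subseteq> drawing xs \<inter> V"
    proof
      fix z assume "z \<in> \<Union>(path_edges xs)"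
      then obtain a where "a \<in> path_edges xs" "z \<in> a" by blast
      moreover then obtain e where "e \<in> E" "a = e \<inter> V" using assms(1) by blast
      ultimately show "z \<in> drawing xs \<inter> V" by (auto simp: drawing_def)
    qed
  qed (auto simp: drawing_def)
  then show ?thesis using Union_path_edges assms(2) by blast
qed

text \<open>Different edges of a plane graph meet only in vertices, and the vertices on each drawing
  are those of its list.\<close>

lemma drawing_Int:
  assumes "path_edges xs \<subseteq> ends E" "path_edges ys \<subseteq> ends E" "length xs \<ge> 2" "length ys \<ge> 2"
    "path_edges xs \<inter> path_edges ys = {}"
  shows "drawing xs \<inter> drawing ys = set xs \<inter> set ys"
proof -
  have "drawing xs \<inter> drawing ys \<subseteq> V"
  proof
    fix z assume "z \<in> drawing xs \<inter> drawing ys"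
    then obtain e e' where e: "e \<in> E" "e' \<in> E" "z \<in> e" "z \<in> e'"
      "e \<inter> V \<in> path_edges xs" "e' \<inter> V \<in> path_edges ys" by (auto simp: drawing_def)
    then have "e \<noteq> e'" using assms(5) by auto
    then show "z \<in> V" using e edges_Int by blast
  qed
  then show ?thesis using drawing_Int_V assms by blast
qed

text \<open>The arcs of the edges are joined one by one; by distinctness the next one meets the rest
  only in their common vertex. The length bound excludes a single vertex, whose drawing is
  empty.\<close>

lemma walk_arc:
  assumes "path_edges xs \<subseteq> ends E" "distinct xs" "length xs \<ge> 2"
  shows "\<exists>g. arc g \<and> path_image g = drawing xs \<and> pathstart g = hd xs \<and> pathfinish g = last xs"
  using assms
proof (induction xs rule: path_edges.induct)
  case (1 x y zs)
  have sub: "path_edges (y # zs) \<subseteq> ends E" "{x, y} \<in> ends E"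
    and dist: "distinct (y # zs)" "x \<notin> set (y # zs)" using "1.prems"(1,2) by auto
  obtain e where e: "e \<in> E" "e \<inter> V = {x, y}" using sub(2) by blast
  have De: "drawing [x, y] = e"
  proof -
    have "\<forall>e'\<in>E. e' \<inter> V \<in> path_edges [x, y] \<longrightarrow> e' = e"
      using edge_eqI[OF _ e(1)] e(2) by simp
    moreover have "e \<inter> V \<in> path_edges [x, y]" using e(2) by simp
    ultimately show ?thesis unfolding drawing_def using e(1) by blast
  qed
  obtain g where g: "arc g" "path_image g = e" "pathstart g = x" "pathfinish g = y"
    by (rule edge_arc[OF e])
  show ?case
  proof (cases zs)
    case Nil
    then show ?thesis using g De by (intro exI[of _ g]) simp
  next
    case (Cons z zs')
    then have len: "length (y # zs) \<ge> 2" by simp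
    obtain h where h: "arc h" "path_image h = drawing (y # zs)" "pathstart h = y" "pathfinish h = last (y # zs)"
      using "1.IH"[OF sub(1) dist(1) len] by auto
    have "path_edges [x, y] \<inter> path_edges (y # zs) = {}"
      using dist(2) path_edges_subset[of "{x, y}" "y # zs"] by auto
    then have "drawing [x, y] \<inter> drawing (y # zs) = set [x, y] \<inter> set (y # zs)"
      by (intro drawing_Int) (use sub len in auto)
    then have "e \<inter> drawing (y # zs) = {y}"
      unfolding De using dist(2) by auto
    then have "arc (g +++ h)"
      using g h by (intro arc_join) simp_all
    moreover have "drawing (x # y # zs) = e \<union> drawing (y # zs)"
      unfolding De[symmetric] by (rule drawing_Un) simp
    ultimately show ?thesis
      using g h by (intro exI[of _ "g +++ h"]) (simp add: path_image_join)
  qed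
qed auto

section \<open>Attaching ears\<close>

text \<open>The exempted face \<open>F0\<close> is the generator that the others make redundant.
  Allowing it keeps the final count sharp without an argument that each edge borders exactly
  two faces.\<close>

definition facial :: "complex set set \<Rightarrow> (complex set \<Rightarrow> complex list) \<Rightarrow> bool" where
  "facial X \<phi> \<longleftrightarrow> X \<subseteq> E \<and> X \<noteq> {} \<and>
    (\<forall>F \<in> components (- \<Union>X). length (\<phi> F) \<ge> 3 \<and> distinct (\<phi> F) \<and>
       path_edges (closed_walk (\<phi> F)) \<subseteq> ends X \<and> frontier F = drawing (closed_walk (\<phi> F))) \<and>
    (\<forall>d F0. symp d \<longrightarrow>
       (\<forall>F \<in> components (- \<Union>X) - {F0}. \<not> odd_walk d (closed_walk (\<phi> F))) \<longrightarrow>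
       (\<exists>f :: complex \<Rightarrow> bool. \<forall>x y. {x, y} \<in> ends X \<longrightarrow> (d x y \<longleftrightarrow> f x \<noteq> f y)))"

text \<open>Subgraphs are given by their edge sets \<open>X\<close>, with
  \<open>V \<inter> \<Union>X\<close> as vertices, so isolated vertices do not occur in them. An
  empty \<open>mid\<close> is allowed: a chord is an ear.\<close>

definition ear :: "complex set set \<Rightarrow> complex \<Rightarrow> complex list \<Rightarrow> complex \<Rightarrow> bool" where
  "ear X u mid w \<longleftrightarrow> u \<in> V \<inter> \<Union>X \<and> w \<in> V \<inter> \<Union>X \<and> distinct (u # mid @ [w]) \<and>
     set mid \<inter> \<Union>X = {} \<and> path_edges (u # mid @ [w]) \<subseteq> ends (E - X)"

abbreviation edges_on :: "complex list \<Rightarrow> complex set set" where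
  "edges_on xs \<equiv> {e \<in> E. e \<inter> V \<in> path_edges xs}"

lemma closed_Union_edges: "X \<subseteq> E \<Longrightarrow> closed (\<Union>X)"
  using finite_VE(2) edge_closed by (intro closed_Union) (auto intro: finite_subset)

lemma ends_edges_on: "path_edges xs \<subseteq> ends E \<Longrightarrow> ends (edges_on xs) = path_edges xs"
  by blast

lemma drawing_subset_Union:
  assumes "path_edges xs \<subseteq> ends X" "X \<subseteq> E"
  shows "drawing xs \<subseteq> \<Union>X"
proof -
  have "edges_on xs \<subseteq> X"
  proof
    fix e assume e: "e \<in> edges_on xs"
    then obtain e' where "e' \<in> X" "e \<inter> V = e' \<inter> V" using assms(1) by blast
    then show "e \<in> X" using edge_eqI[of e e'] e assms(2) by blast
  qed
  then show ?thesis unfolding drawing_def by blast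
qed

lemma edges_on_disjoint:
  assumes "path_edges xs \<subseteq> ends (E - X)" "X \<subseteq> E"
  shows "edges_on xs \<inter> X = {}"
proof (rule ccontr)
  assume "\<not> ?thesis"
  then obtain e where e: "e \<in> X" "e \<in> E" "e \<inter> V \<in> path_edges xs" by blast
  then obtain e' where "e' \<in> E - X" "e \<inter> V = e' \<inter> V" using assms(1) by blast
  then show False using e edge_eqI[of e e'] by blast
qed

text \<open>Points common to different edges are vertices, and the only vertices of an ear that lie
  on \<open>X\<close> are its ends.\<close>

lemma drawing_ear_Int:
  assumes "ear X u mid w" "X \<subseteq> E"
  shows "drawing (u # mid @ [w]) \<inter> \<Union>X = {u, w}"
proof -
  let ?ps = "u # mid @ [w]"
  have sub: "path_edges ?ps \<subseteq> ends (E - X)" "path_edges ?ps \<subseteq> ends E"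
    using assms unfolding ear_def by blast+
  have V: "drawing ?ps \<inter> V = set ?ps" by (rule drawing_Int_V[OF sub(2)]) simp
  have "drawing ?ps \<inter> \<Union>X \<subseteq> V"
  proof
    fix z assume "z \<in> drawing ?ps \<inter> \<Union>X"
    then obtain e e' where e: "e \<in> edges_on ?ps" "z \<in> e" "e' \<in> X" "z \<in> e'"
      unfolding drawing_def by blast
    moreover have "e \<noteq> e'" using edges_on_disjoint[OF sub(1) assms(2)] e by blast
    ultimately show "z \<in> V" using edges_Int[of e e'] assms(2) by blast
  qed
  then have "drawing ?ps \<inter> \<Union>X = set ?ps \<inter> \<Union>X" using V by blast
  also have "\<dots> = {u, w}" using assms(1) unfolding ear_def by auto
  finally show ?thesis .
qed

text \<open>The cycle is rotated to start at \<open>u\<close> and then cut at \<open>w\<close>.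
  Length at least 3 prevents both parts from being single edges, which is what keeps them
  edge-disjoint.\<close>

lemma facial_cycle_split:
  assumes vs: "length vs \<ge> 3" "distinct vs" "u \<in> set vs" "w \<in> set vs" "u \<noteq> w"
  obtains q1 q2 where "distinct (u # q1 @ w # q2)" "q1 \<noteq> [] \<or> q2 \<noteq> []"
    "set vs = set (u # q1 @ w # q2)"
    "path_edges (closed_walk vs) = path_edges (u # q1 @ [w]) \<union> path_edges (w # q2 @ [u])"
    "\<And>d. odd_walk d (closed_walk vs) \<longleftrightarrow> odd_walk d (u # q1 @ [w]) \<noteq> odd_walk d (w # q2 @ [u])"
proof -
  obtain xs t where xs: "vs = xs @ u # t" using vs(3) by (meson split_list)
  then have "w \<in> set (t @ xs)" using vs by auto
  then obtain q1 q2 where q: "t @ xs = q1 @ w # q2" by (meson split_list)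
  have len: "length vs = Suc (Suc (length q1 + length q2))"
    using arg_cong[OF q, of length] xs by simp
  have set: "set vs = set (u # q1 @ w # q2)"
    using arg_cong[OF q, of set] xs by auto
  show thesis
  proof (rule that)
    have "distinct (u # t @ xs)" using vs(2) xs by auto
    then show "distinct (u # q1 @ w # q2)" unfolding q .
    show "q1 \<noteq> [] \<or> q2 \<noteq> []" using len vs(1) by auto
    show "path_edges (closed_walk vs) = path_edges (u # q1 @ [w]) \<union> path_edges (w # q2 @ [u])"
      using path_edges_append[of "u # q1" w "q2 @ [u]"]
      unfolding xs path_edges_rotate q by simp
    show "odd_walk d (closed_walk vs) \<longleftrightarrow> odd_walk d (u # q1 @ [w]) \<noteq> odd_walk d (w # q2 @ [u])" for d
      using odd_walk_append[of d "u # q1" w "q2 @ [u]"]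
      unfolding xs odd_walk_rotate q by simp
  qed (rule set)
qed

text \<open>A common edge could only be \<open>{u, w}\<close>, but a part with inner vertices does
  not contain that edge.\<close>

lemma cycle_arcs_disjoint:
  assumes "distinct (u # q1 @ w # q2)" "q1 \<noteq> [] \<or> q2 \<noteq> []"
  shows "path_edges (u # q1 @ [w]) \<inter> path_edges (w # q2 @ [u]) = {}"
proof (rule ccontr)
  assume "\<not> ?thesis"
  then obtain e where e: "e \<in> path_edges (u # q1 @ [w])" "e \<in> path_edges (w # q2 @ [u])" by blast
  have d: "distinct (u # q1 @ [w])" "distinct (w # q2 @ [u])" using assms(1) by auto
  have "e \<subseteq> {u, w}" using path_edges_subset[OF e(1)] path_edges_subset[OF e(2)] assms(1) by auto
  moreover obtain x y where "e = {x, y}" "x \<noteq> y" using path_edgesE[OF e(1) d(1)] by metis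
  ultimately have "e = {u, w}" by auto
  then show False
    using e ends_in_path_edges_iff[OF d(1)] ends_in_path_edges_iff[OF d(2)] assms(2)
    by (simp add: insert_commute)
qed

text \<open>The potential is propagated along the ear from \<open>u\<close>. The parity condition
  makes it arrive at \<open>w\<close> with the old value, so only inner vertices change, and these
  lie off \<open>X\<close>.\<close>

lemma potential_extend_ear:
  fixes f :: "complex \<Rightarrow> bool"
  assumes ear: "ear X u mid w" and d: "symp d" and X: "X \<subseteq> E"
    and f: "\<forall>x y. {x, y} \<in> ends X \<longrightarrow> (d x y \<longleftrightarrow> f x \<noteq> f y)"
    and par: "odd_walk d (u # mid @ [w]) \<longleftrightarrow> f u \<noteq> f w"
  shows "\<exists>f :: complex \<Rightarrow> bool. \<forall>x y. {x, y} \<in> ends X \<union> path_edges (u # mid @ [w]) \<longrightarrow> (d x y \<longleftrightarrow> f x \<noteq> f y)"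
proof -
  have dist: "distinct (u # mid @ [w])" "set mid \<inter> \<Union>X = {}" using ear unfolding ear_def by auto
  obtain g where g: "\<forall>z. z \<notin> set (mid @ [w]) \<longrightarrow> g z = f z"
    "\<forall>a b. {a, b} \<in> path_edges (u # mid @ [w]) \<longrightarrow> (d a b \<longleftrightarrow> g a \<noteq> g b)"
    using exists_potential[OF d dist(1), of f] by (elim exE conjE)
  have "odd_walk d (u # mid @ [w]) \<longleftrightarrow> g (hd (u # mid @ [w])) \<noteq> g (last (u # mid @ [w]))"
    by (rule odd_walk_potential) (use g(2) in auto)
  then have "f u \<noteq> f w \<longleftrightarrow> g u \<noteq> g w" using par by simp
  moreover have "g u = f u" using g(1) dist(1) by auto
  ultimately have "g w = f w" by auto
  then have eq: "g z = f z" if "z \<notin> set mid" for z using g(1) that by auto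
  have "d x y \<longleftrightarrow> g x \<noteq> g y" if "{x, y} \<in> ends X" for x y
  proof -
    have "{x, y} \<subseteq> \<Union>X" using that by blast
    then have "x \<notin> set mid" "y \<notin> set mid" using dist(2) by blast+
    then show ?thesis using eq f that by simp
  qed
  with g(2) show ?thesis by (intro exI[of _ g]) blast
qed

text \<open>Continuity carries the closure of the open parameter interval into the closure of the
  open arc. For an ear drawn in a face, this puts its ends into the closure of the face.\<close>

lemma closure_arc_interior:
  fixes g :: "real \<Rightarrow> complex"
  assumes "arc g"
  shows "path_image g \<subseteq> closure (path_image g - {pathstart g, pathfinish g})"
proof -
  have "path_image g - {pathstart g, pathfinish g} = g ` {0<..<1}"
    using assms by (simp add: arc_imp_simple_path simple_path_endless)
  moreover have "g ` closure {0<..<1} \<subseteq> closure (g ` {0<..<1})"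
    by (rule image_closure_subset)
      (use assms closure_subset[of "g ` {0<..<1}"] in \<open>auto simp: arc_def path_def\<close>)
  ultimately show ?thesis by (simp add: path_image_def)
qed

text \<open>The base of the ear induction: an edge together with an ear on its two ends is a cycle.
  Both its faces have this cycle as boundary, and a potential built along the ear agrees with the
  remaining edge exactly when the cycle is even.\<close>

lemma facial_cycle:
  assumes e: "e \<in> E" and ear: "ear {e} u mid w"
  shows "\<exists>\<phi>. facial ({e} \<union> edges_on (u # mid @ [w])) \<phi>"
proof -
  let ?ps = "u # mid @ [w]" and ?N = "edges_on (u # mid @ [w])"
  have sub: "path_edges ?ps \<subseteq> ends (E - {e})" "path_edges ?ps \<subseteq> ends E"
    and dist: "distinct ?ps" and uw: "u \<in> V" "w \<in> V" "u \<in> e" "w \<in> e"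
    using ear unfolding ear_def by blast+
  obtain x y where xy: "e \<inter> V = {x, y}" "x \<noteq> y" by (rule edge_ends[OF e])
  then have "{w, u} \<subseteq> {x, y}" using uw by blast
  moreover have "w \<noteq> u" using dist by auto
  ultimately have "{x, y} = {w, u}" by auto
  with xy(1) have euw: "e \<inter> V = {w, u}" by simp
  \<comment> \<open>Otherwise the ear would be a second edge with the ends of
    \<open>e\<close>.\<close>
  have mid: "mid \<noteq> []"
  proof
    assume "mid = []"
    then have "{u, w} \<in> ends (E - {e})" using sub by simp
    then obtain e' where "e' \<in> E - {e}" "e' \<inter> V = {u, w}" by blast
    then show False using edge_eqI[of e' e] e euw by blast
  qed
  have edges: "path_edges (closed_walk ?ps) = insert {w, u} (path_edges ?ps)"
    using path_edges_append[of "u # mid" w "[u]"] by simp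
  have drw: "drawing (closed_walk ?ps) = drawing ?ps \<union> e"
  proof -
    have "drawing (closed_walk ?ps) = drawing ?ps \<union> drawing [w, u]"
      by (rule drawing_Un) (use edges in simp)
    moreover have "drawing [w, u] = e"
    proof -
      have "\<forall>e'\<in>E. e' \<inter> V \<in> path_edges [w, u] \<longrightarrow> e' = e"
        using edge_eqI[OF _ e] euw by simp
      moreover have "e \<inter> V \<in> path_edges [w, u]" using euw by simp
      ultimately show ?thesis unfolding drawing_def using e by blast
    qed
    ultimately show ?thesis by simp
  qed
  have Un: "\<Union>({e} \<union> ?N) = drawing (closed_walk ?ps)"
    unfolding drw by (auto simp: drawing_def)
  obtain r where r: "arc r" "path_image r = drawing ?ps" "pathstart r = u" "pathfinish r = w"
    using walk_arc[OF sub(2) dist] by auto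
  obtain g where g: "arc g" "path_image g = e" "pathstart g = u" "pathfinish g = w"
    using edge_arc[OF e, of u w] euw by (metis insert_commute)
  have "path_image r \<inter> path_image g = {u, w}"
    using drawing_ear_Int[OF ear] e r g by simp
  from jordan_curve_arcs[OF r(1) g(1) r(3,4) g(3,4) this]
  have j: "jordan_curve (drawing (closed_walk ?ps))" unfolding drw r g .
  have "facial ({e} \<union> ?N) (\<lambda>_. ?ps)"
    unfolding facial_def Un components_jordan_curve[OF j]
  proof (intro conjI ballI allI impI)
    show "{e} \<union> ?N \<subseteq> E" using e by blast
    show "3 \<le> length ?ps" using mid by (cases mid) auto
    show "path_edges (closed_walk ?ps) \<subseteq> ends ({e} \<union> ?N)"
      unfolding edges image_Un ends_edges_on[OF sub(2)] using euw by auto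
    show "frontier F = drawing (closed_walk ?ps)" if
      "F \<in> {inside (drawing (closed_walk ?ps)), outside (drawing (closed_walk ?ps))}" for F
      using that jordan_curve_inside_outside(9,10)[OF j] by blast
  next
    fix d F0
    assume d: "symp d" and "\<forall>F\<in>{inside (drawing (closed_walk ?ps)), outside (drawing (closed_walk ?ps))} - {F0}.
      \<not> odd_walk d (closed_walk ?ps)"
    \<comment> \<open>The two faces differ, so at least one of them is not exempt.\<close>
    moreover have "inside (drawing (closed_walk ?ps)) \<noteq> outside (drawing (closed_walk ?ps))"
      using jordan_curve_inside_outside(1,7)[OF j] by blast
    ultimately have even: "\<not> odd_walk d (closed_walk ?ps)" by blast
    obtain f :: "complex \<Rightarrow> bool" where f: "\<forall>a b. {a, b} \<in> path_edges ?ps \<longrightarrow> (d a b \<longleftrightarrow> f a \<noteq> f b)"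
      using exists_potential[OF d dist, of "\<lambda>_. False"] by (elim exE conjE)
    have "odd_walk d ?ps \<longleftrightarrow> f (hd ?ps) \<noteq> f (last ?ps)"
      by (rule odd_walk_potential) (use f in auto)
    moreover have "odd_walk d (closed_walk ?ps) \<longleftrightarrow> odd_walk d ?ps \<noteq> odd_walk d [w, u]"
      using odd_walk_append[of d "u # mid" w "[u]"] by simp
    ultimately have wu: "d w u \<longleftrightarrow> f w \<noteq> f u" "d u w \<longleftrightarrow> f u \<noteq> f w"
      using even d by (auto dest: sympD)
    have "d x y \<longleftrightarrow> f x \<noteq> f y" if xy: "{x, y} \<in> ends ({e} \<union> ?N)" for x y
    proof -
      have "{x, y} = {w, u} \<or> {x, y} \<in> path_edges ?ps"
        using xy unfolding image_Un ends_edges_on[OF sub(2)] using euw by simp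
      then show ?thesis using f wu by (auto simp: doubleton_eq_iff)
    qed
    then show "\<exists>f :: complex \<Rightarrow> bool. \<forall>x y. {x, y} \<in> ends ({e} \<union> ?N) \<longrightarrow> (d x y \<longleftrightarrow> f x \<noteq> f y)"
      by (intro exI[of _ f] allI impI)
  qed (use dist in auto)
  then show ?thesis by blast
qed

text \<open>The components of an open set are recognised as its only partition into nonempty open
  connected sets; the new family is such a partition.\<close>

lemma components_after_ear:
  assumes X: "X \<subseteq> E" and F: "F \<in> components (- \<Union>X)"
    and P: "\<Union>Y \<subseteq> \<Union>X \<union> F"
    and F12: "open F1" "connected F1" "F1 \<noteq> {}" "open F2" "connected F2" "F2 \<noteq> {}"
      "F1 \<inter> F2 = {}" "F1 \<union> F2 = F - \<Union>Y"
  shows "components (- \<Union>(X \<union> Y)) = (components (- \<Union>X) - {F}) \<union> {F1, F2}"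
proof (rule components_open_unique)
  let ?C = "components (- \<Union>X)"
  have disj: "A \<inter> B = {}" if "A \<in> ?C" "B \<in> ?C" "A \<noteq> B" for A B
    using components_nonoverlap[OF that(1,2)] that(3) by blast
  have sub: "F1 \<subseteq> F" "F2 \<subseteq> F" using F12(8) by blast+
  have d: "disjnt A F1" "disjnt A F2" "disjnt F1 A" "disjnt F2 A" if "A \<in> ?C - {F}" for A
  proof -
    have "A \<inter> F = {}" by (rule disj) (use that F in auto)
    then show "disjnt A F1" "disjnt A F2" "disjnt F1 A" "disjnt F2 A"
      using sub unfolding disjnt_def by blast+
  qed
  have F12d: "disjnt F1 F2" "disjnt F2 F1" using F12(7) unfolding disjnt_def by blast+
  show "pairwise disjnt ((?C - {F}) \<union> {F1, F2})"
  proof (rule pairwiseI)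
    fix A B assume AB: "A \<in> (?C - {F}) \<union> {F1, F2}" "B \<in> (?C - {F}) \<union> {F1, F2}" "A \<noteq> B"
    show "disjnt A B"
    proof (cases "A \<in> ?C - {F} \<and> B \<in> ?C - {F}")
      case True
      then show ?thesis using disj[of A B] AB(3) unfolding disjnt_def by blast
    next
      case False
      then show ?thesis using AB d F12d by (elim UnE insertE emptyE) simp_all
    qed
  qed
  have "\<Union>?C = - \<Union>X" by (rule Union_components)
  moreover have "\<Union>(?C - {F}) \<inter> F = {}"
    unfolding Int_Union2 using disj[OF _ F] by simp
  moreover have "\<Union>?C = \<Union>(?C - {F}) \<union> F" using F by blast
  ultimately have CF: "\<Union>(?C - {F}) = - \<Union>X - F" by blast
  have "F \<subseteq> - \<Union>X" using in_components_subset[OF F] .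
  then have "(- \<Union>X - F) \<union> (F - \<Union>Y) = - (\<Union>X \<union> \<Union>Y)" using P by blast
  moreover have "\<Union>((?C - {F}) \<union> {F1, F2}) = \<Union>(?C - {F}) \<union> (F1 \<union> F2)"
    by (simp only: Union_Un_distrib Union_insert Union_empty Un_empty_right)
  ultimately show "\<Union>((?C - {F}) \<union> {F1, F2}) = - \<Union>(X \<union> Y)"
    unfolding CF F12(8) Union_Un_distrib by simp
  show "open A \<and> connected A \<and> A \<noteq> {}" if "A \<in> (?C - {F}) \<union> {F1, F2}" for A
    using that F12 in_components_connected in_components_nonempty
      open_components[OF open_Compl[OF closed_Union_edges[OF X]]] by blast
qed

text \<open>The inner part of the ear lies in one face \<open>F\<close>, and its ends split the
  boundary cycle of \<open>F\<close> into two arcs. With the ear these form a theta curve, so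
  \<open>F\<close> is replaced by two faces, each bounded by one of the arcs and the ear.\<close>

lemma facial_ear:
  assumes fac: "facial X \<phi>" and ear: "ear X u mid w"
  shows "\<exists>\<phi>. facial (X \<union> edges_on (u # mid @ [w])) \<phi>"
proof -
  let ?ps = "u # mid @ [w]" and ?N = "edges_on (u # mid @ [w])" and ?C = "components (- \<Union>X)"
  note fac_conj = fac[unfolded facial_def]
  have X: "X \<subseteq> E" "X \<noteq> {}"
    using fac_conj[THEN conjunct1] fac_conj[THEN conjunct2, THEN conjunct1] by simp_all
  have \<phi>: "length (\<phi> F) \<ge> 3" "distinct (\<phi> F)" "path_edges (closed_walk (\<phi> F)) \<subseteq> ends X"
    "frontier F = drawing (closed_walk (\<phi> F))" if "F \<in> ?C" for F
    using bspec[OF fac_conj[THEN conjunct2, THEN conjunct2, THEN conjunct1] that] by simp_all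
  have pot: "\<exists>f :: complex \<Rightarrow> bool. \<forall>x y. {x, y} \<in> ends X \<longrightarrow> (d x y \<longleftrightarrow> f x \<noteq> f y)"
    if "symp d" "\<forall>F \<in> ?C - {F0}. \<not> odd_walk d (closed_walk (\<phi> F))" for d F0
    by (rule fac_conj[THEN conjunct2, THEN conjunct2, THEN conjunct2, THEN spec, THEN spec,
          THEN mp, THEN mp, OF that])
  have sub: "path_edges ?ps \<subseteq> ends (E - X)" "path_edges ?ps \<subseteq> ends E"
    and dist: "distinct ?ps" and uwV: "u \<in> V" "w \<in> V" "u \<in> \<Union>X" "w \<in> \<Union>X"
    and midX: "set mid \<inter> \<Union>X = {}"
    using ear unfolding ear_def by blast+
  have uw: "u \<noteq> w" using dist by auto
  obtain r where r: "arc r" "path_image r = drawing ?ps" "pathstart r = u" "pathfinish r = w"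
    using walk_arc[OF sub(2) dist] by auto
  have PX: "drawing ?ps \<inter> \<Union>X = {u, w}" by (rule drawing_ear_Int[OF ear X(1)])
  let ?I = "drawing ?ps - {u, w}"
  have I: "connected ?I" "?I \<noteq> {}"
    using connected_simple_path_endless[of r] nonempty_simple_path_endless[of r] r
    by (simp_all add: arc_imp_simple_path)
  have IX: "?I \<subseteq> - \<Union>X" using PX by blast
  obtain F where F: "F \<in> ?C" "?I \<subseteq> F"
    using exists_component_superset[OF IX _ I(1)] I(2) IX by blast
  have FX: "F \<subseteq> - \<Union>X" by (rule in_components_subset[OF F(1)])
  note \<phi>F = \<phi>[OF F(1)]
  \<comment> \<open>The ends of the ear are limits of points of \<open>F\<close> but lie on
    \<open>X\<close>, so they belong to the frontier of \<open>F\<close> and hence are vertices of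
    its cycle.\<close>
  have cl: "drawing ?ps \<subseteq> closure F"
    using closure_arc_interior[OF r(1)] closure_mono[OF F(2)] r by auto
  have inP: "u \<in> drawing ?ps" "w \<in> drawing ?ps" using PX by blast+
  have "u \<notin> F" "w \<notin> F" using FX uwV by blast+
  then have "u \<in> frontier F" "w \<in> frontier F"
    using cl inP interior_subset unfolding frontier_def by blast+
  then have "u \<in> drawing (closed_walk (\<phi> F)) \<inter> V" "w \<in> drawing (closed_walk (\<phi> F)) \<inter> V"
    using \<phi>F(4) uwV by auto
  moreover have "drawing (closed_walk (\<phi> F)) \<inter> V = set (closed_walk (\<phi> F))"
    by (rule drawing_Int_V) (use \<phi>F(1,3) X(1) in auto)
  moreover have "set (closed_walk (\<phi> F)) = set (\<phi> F)" using \<phi>F(1) by (cases "\<phi> F") auto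
  ultimately have on: "u \<in> set (\<phi> F)" "w \<in> set (\<phi> F)" by auto
  obtain q1 q2 where q: "distinct (u # q1 @ w # q2)" "q1 \<noteq> [] \<or> q2 \<noteq> []"
    "set (\<phi> F) = set (u # q1 @ w # q2)"
    "path_edges (closed_walk (\<phi> F)) = path_edges (u # q1 @ [w]) \<union> path_edges (w # q2 @ [u])"
    "\<And>d. odd_walk d (closed_walk (\<phi> F)) \<longleftrightarrow> odd_walk d (u # q1 @ [w]) \<noteq> odd_walk d (w # q2 @ [u])"
    using facial_cycle_split[OF \<phi>F(1,2) on uw] by metis
  let ?Q1 = "u # q1 @ [w]" and ?Q2 = "w # q2 @ [u]"
  have Qsub: "path_edges ?Q1 \<subseteq> ends X" "path_edges ?Q2 \<subseteq> ends X" using \<phi>F(3) q(4) by blast+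
  have QsubE: "path_edges ?Q1 \<subseteq> ends E" "path_edges (rev ?Q2) \<subseteq> ends E"
    using Qsub X(1) unfolding path_edges_rev by blast+
  have Qdist: "distinct ?Q1" "distinct (rev ?Q2)" using q(1) by auto
  obtain c1 where c1: "arc c1" "path_image c1 = drawing ?Q1" "pathstart c1 = u" "pathfinish c1 = w"
    using walk_arc[OF QsubE(1) Qdist(1)] by auto
  have drev: "drawing (rev xs) = drawing xs" for xs unfolding drawing_def path_edges_rev ..
  obtain c2 where c2: "arc c2" "path_image c2 = drawing ?Q2" "pathstart c2 = u" "pathfinish c2 = w"
    using walk_arc[OF QsubE(2) Qdist(2)] unfolding drev by auto
  have "drawing ?Q1 \<inter> drawing ?Q2 = set ?Q1 \<inter> set ?Q2"
    by (rule drawing_Int[OF QsubE(1) QsubE(2)[unfolded path_edges_rev] _ _ cycle_arcs_disjoint[OF q(1,2)]])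
      simp_all
  also have "\<dots> = {u, w}" using q(1) by auto
  finally have QQ: "drawing ?Q1 \<inter> drawing ?Q2 = {u, w}" .
  have "drawing ?Q1 \<subseteq> \<Union>X" "drawing ?Q2 \<subseteq> \<Union>X"
    using drawing_subset_Union[OF _ X(1)] Qsub by blast+
  then have QP: "drawing ?Q1 \<inter> drawing ?ps = {u, w}" "drawing ?Q2 \<inter> drawing ?ps = {u, w}"
    using PX QQ by blast+
  have dF: "drawing (closed_walk (\<phi> F)) = drawing ?Q1 \<union> drawing ?Q2"
    by (rule drawing_Un[OF q(4)])
  have j: "jordan_curve (drawing ?Q1 \<union> drawing ?Q2)" "jordan_curve (drawing ?Q1 \<union> drawing ?ps)"
    "jordan_curve (drawing ?Q2 \<union> drawing ?ps)"
    using jordan_curve_arcs[OF c1(1) c2(1) c1(3,4) c2(3,4)] jordan_curve_arcs[OF c1(1) r(1) c1(3,4) r(3,4)]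
      jordan_curve_arcs[OF c2(1) r(1) c2(3,4) r(3,4)] QQ QP c1(2) c2(2) r(2) by auto
  have oF: "open F" by (rule open_components[OF open_Compl[OF closed_Union_edges[OF X(1)]] F(1)])
  \<comment> \<open>Forgetting all edges off its boundary leaves \<open>F\<close> a face, which
    brings the situation into the form of \<open>theta_split\<close>.\<close>
  have "F \<in> components (- (drawing ?Q1 \<union> drawing ?Q2))"
    by (rule component_eq_if_frontier_jordan_curve[OF j(1) oF])
      (use F(1) in_components_connected in_components_nonempty \<phi>F(4) dF in auto)
  then obtain F1 F2 where F12: "F1 \<in> components (- (drawing ?Q1 \<union> drawing ?ps))"
    "F2 \<in> components (- (drawing ?Q2 \<union> drawing ?ps))" "F1 \<inter> F2 = {}" "F1 \<union> F2 = F - drawing ?ps"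
    using theta_split[OF c1(1) c2(1) r(1) c1(3,4) c2(3,4) r(3,4)] QQ QP c1(2) c2(2) r(2) F(2) by metis
  have F12': "open F1" "connected F1" "F1 \<noteq> {}" "frontier F1 = drawing ?Q1 \<union> drawing ?ps"
    "open F2" "connected F2" "F2 \<noteq> {}" "frontier F2 = drawing ?Q2 \<union> drawing ?ps"
    using F12(1,2) jordan_curve_inside_outside[OF j(2)] jordan_curve_inside_outside[OF j(3)]
    unfolding components_jordan_curve[OF j(2)] components_jordan_curve[OF j(3)] by auto
  have UN: "\<Union>?N = drawing ?ps" unfolding drawing_def ..
  have comp: "components (- \<Union>(X \<union> ?N)) = (?C - {F}) \<union> {F1, F2}"
  proof (rule components_after_ear[OF X(1) F(1)])
    show "\<Union>?N \<subseteq> \<Union>X \<union> F" unfolding UN using F(2) PX by blast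
    show "F1 \<union> F2 = F - \<Union>?N" unfolding UN by (rule F12(4))
  qed (use F12' F12(3) in auto)
  have new: "F1 \<noteq> F2" "F1 \<notin> ?C - {F}" "F2 \<notin> ?C - {F}"
  proof -
    show "F1 \<noteq> F2" using F12(3) F12'(3) by blast
    have "F1 \<inter> F \<noteq> {}" "F2 \<inter> F \<noteq> {}" using F12(4) F12'(3,7) by blast+
    then show "F1 \<notin> ?C - {F}" "F2 \<notin> ?C - {F}" using components_nonoverlap F(1) by blast+
  qed
  \<comment> \<open>Each new cycle runs along the ear and one of the two old arcs; \<open>L1\<close>
    takes the ear backwards.\<close>
  define L1 where "L1 = u # q1 @ w # rev mid"
  define L2 where "L2 = u # mid @ w # q2"
  define \<psi> where "\<psi> = \<phi>(F1 := L1, F2 := L2)"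
  have \<psi>: "\<psi> F1 = L1" "\<psi> F2 = L2" "\<And>G. G \<in> ?C - {F} \<Longrightarrow> \<psi> G = \<phi> G"
    using new unfolding \<psi>_def by auto
  have c1L: "closed_walk L1 = u # q1 @ w # rev mid @ [u]" and c2L: "closed_walk L2 = u # mid @ w # q2 @ [u]"
    unfolding L1_def L2_def by simp_all
  have revps: "w # rev mid @ [u] = rev ?ps" by simp
  have pL: "path_edges (closed_walk L1) = path_edges ?Q1 \<union> path_edges ?ps"
    "path_edges (closed_walk L2) = path_edges ?Q2 \<union> path_edges ?ps"
    unfolding c1L c2L
    using path_edges_append[of "u # q1" w "rev mid @ [u]"] path_edges_append[of "u # mid" w "q2 @ [u]"]
    unfolding revps path_edges_rev by (simp_all add: Un_commute)
  have oL: "odd_walk d (closed_walk L1) \<longleftrightarrow> odd_walk d ?Q1 \<noteq> odd_walk d ?ps"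
    "odd_walk d (closed_walk L2) \<longleftrightarrow> odd_walk d ?ps \<noteq> odd_walk d ?Q2" if "symp d" for d
    unfolding c1L c2L
    using odd_walk_append[of d "u # q1" w "rev mid @ [u]"] odd_walk_append[of d "u # mid" w "q2 @ [u]"]
    unfolding revps odd_walk_rev[OF that] by simp_all
  have setX: "set (\<phi> F) \<subseteq> \<Union>X"
  proof -
    have "\<Union>(path_edges (closed_walk (\<phi> F))) = set (closed_walk (\<phi> F))"
      by (rule Union_path_edges) (use \<phi>F(1) in simp)
    then have "set (\<phi> F) \<subseteq> \<Union>(path_edges (closed_walk (\<phi> F)))" by (simp add: subset_insertI)
    also have "\<dots> \<subseteq> \<Union>(ends X)" by (rule Union_mono[OF \<phi>F(3)])
    also have "\<dots> \<subseteq> \<Union>X" by blast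
    finally show ?thesis .
  qed
  have mid: "set mid \<inter> set (u # q1 @ w # q2) = {}" using midX setX unfolding q(3) by blast
  \<comment> \<open>If the ear and an old arc were both single edges, they would be the same edge,
    while the ear is drawn off \<open>X\<close> except for its ends. This gives the new cycles
    length at least 3.\<close>
  have nomid: "mid \<noteq> [] \<or> q1 \<noteq> []" "mid \<noteq> [] \<or> q2 \<noteq> []"
  proof -
    have "\<not> path_edges ?ps \<subseteq> ends X"
    proof
      assume "path_edges ?ps \<subseteq> ends X"
      then have "\<Union>?N \<subseteq> \<Union>X" unfolding UN by (rule drawing_subset_Union[OF _ X(1)])
      then show False using UN IX I(2) by blast
    qed
    then have "path_edges ?ps \<noteq> path_edges ?Q1" "path_edges ?ps \<noteq> path_edges (rev ?Q2)"
      using Qsub unfolding path_edges_rev by metis+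
    then show "mid \<noteq> [] \<or> q1 \<noteq> []" "mid \<noteq> [] \<or> q2 \<noteq> []" by auto
  qed
  have len: "length L1 \<ge> 3" "length L2 \<ge> 3"
    unfolding L1_def L2_def using nomid by (cases mid; cases q1; cases q2; simp)+
  have distL: "distinct L1" "distinct L2"
    unfolding L1_def L2_def using q(1) dist mid by auto
  have endsN: "ends (X \<union> ?N) = ends X \<union> path_edges ?ps"
    unfolding image_Un ends_edges_on[OF sub(2)] ..
  have "facial (X \<union> ?N) \<psi>"
    unfolding facial_def comp
  proof (intro conjI)
    show "X \<union> ?N \<subseteq> E" "X \<union> ?N \<noteq> {}" using X by blast+
    show "\<forall>G \<in> (?C - {F}) \<union> {F1, F2}. length (\<psi> G) \<ge> 3 \<and> distinct (\<psi> G) \<and>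
      path_edges (closed_walk (\<psi> G)) \<subseteq> ends (X \<union> ?N) \<and> frontier G = drawing (closed_walk (\<psi> G))"
    proof
      fix G assume "G \<in> (?C - {F}) \<union> {F1, F2}"
      then consider "G \<in> ?C - {F}" | "G = F1" | "G = F2" by blast
      then show "length (\<psi> G) \<ge> 3 \<and> distinct (\<psi> G) \<and>
        path_edges (closed_walk (\<psi> G)) \<subseteq> ends (X \<union> ?N) \<and> frontier G = drawing (closed_walk (\<psi> G))"
      proof cases
        case 1
        then have "G \<in> ?C" by blast
        from \<phi>[OF this] show ?thesis unfolding \<psi>(3)[OF 1] endsN by blast
      next
        case 2
        have "frontier F1 = drawing (closed_walk L1)" using F12'(4) drawing_Un[OF pL(1)] by simp
        then show ?thesis unfolding 2 \<psi> endsN using len distL pL(1) Qsub by blast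
      next
        case 3
        have "frontier F2 = drawing (closed_walk L2)" using F12'(8) drawing_Un[OF pL(2)] by simp
        then show ?thesis unfolding 3 \<psi> endsN using len distL pL(2) Qsub by blast
      qed
    qed
    show "\<forall>d F0. symp d \<longrightarrow>
       (\<forall>G \<in> (?C - {F}) \<union> {F1, F2} - {F0}. \<not> odd_walk d (closed_walk (\<psi> G))) \<longrightarrow>
       (\<exists>f :: complex \<Rightarrow> bool. \<forall>x y. {x, y} \<in> ends (X \<union> ?N) \<longrightarrow> (d x y \<longleftrightarrow> f x \<noteq> f y))"
    proof (intro allI impI)
      fix d F0
      assume d: "symp d" and ev: "\<forall>G \<in> (?C - {F}) \<union> {F1, F2} - {F0}. \<not> odd_walk d (closed_walk (\<psi> G))"
      \<comment> \<open>If a new face is exempt, the exemption passes to its parent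
        \<open>F\<close>. The other new face is still even, and that will determine the parity of
        the ear.\<close>
      define F0' where "F0' = (if F0 = F1 \<or> F0 = F2 then F else F0)"
      have one: "\<not> odd_walk d (closed_walk L1) \<or> \<not> odd_walk d (closed_walk L2)"
        using ev new(1) \<psi>(1,2) by (metis Diff_iff UnCI insertCI singletonD)
      have "\<not> odd_walk d (closed_walk (\<phi> G))" if G: "G \<in> ?C - {F0'}" for G
      proof (cases "G = F")
        case True
        \<comment> \<open>Both new faces are even here; in their sum the ear is counted twice and
          cancels, leaving the old cycle of \<open>F\<close>.\<close>
        then have "F0 \<noteq> F1" "F0 \<noteq> F2" using G unfolding F0'_def by auto
        then have "\<not> odd_walk d (closed_walk L1)" "\<not> odd_walk d (closed_walk L2)"
          using ev \<psi>(1,2) by (metis Diff_iff UnCI insertCI singletonD)+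
        then show ?thesis unfolding True q(5) using oL[OF d] by blast
      next
        case False
        then have G': "G \<in> ?C - {F}" using G by blast
        moreover have "G \<noteq> F0" using G G' new(2,3) unfolding F0'_def by (auto split: if_splits)
        ultimately show ?thesis using ev \<psi>(3)[OF G'] by (metis Diff_iff UnI1 singletonD)
      qed
      then have "\<forall>G \<in> ?C - {F0'}. \<not> odd_walk d (closed_walk (\<phi> G))" by (rule ballI)
      from pot[OF d this] obtain f :: "complex \<Rightarrow> bool"
        where f: "\<forall>x y. {x, y} \<in> ends X \<longrightarrow> (d x y \<longleftrightarrow> f x \<noteq> f y)" by (elim exE)
      have "odd_walk d ?Q1 \<longleftrightarrow> f (hd ?Q1) \<noteq> f (last ?Q1)" "odd_walk d ?Q2 \<longleftrightarrow> f (hd ?Q2) \<noteq> f (last ?Q2)"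
        by (rule odd_walk_potential[OF f[rule_format, OF subsetD[OF Qsub(1)]]], assumption, simp)
          (rule odd_walk_potential[OF f[rule_format, OF subsetD[OF Qsub(2)]]], assumption, simp)
      then have "odd_walk d ?Q1 \<longleftrightarrow> f u \<noteq> f w" "odd_walk d ?Q2 \<longleftrightarrow> f w \<noteq> f u" by simp_all
      \<comment> \<open>One even new cycle suffices: on it the ear has the parity of the old arc,
        which is the change of \<open>f\<close> between \<open>u\<close> and
        \<open>w\<close>.\<close>
      then have "odd_walk d ?ps \<longleftrightarrow> f u \<noteq> f w" using one oL[OF d] by blast
      from potential_extend_ear[OF ear d X(1) f this]
      show "\<exists>f :: complex \<Rightarrow> bool. \<forall>x y. {x, y} \<in> ends (X \<union> ?N) \<longrightarrow> (d x y \<longleftrightarrow> f x \<noteq> f y)"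
        unfolding endsN .
    qed
  qed
  then show ?thesis by blast
qed

end

section \<open>Minimal cuts\<close>

lemma del_verts_simps:
  "gverts (del_verts G S) = gverts G - S"
  "gedges (del_verts G S) = {e \<in> gedges G. e \<subseteq> gverts G - S}"
  unfolding del_verts_def induced_def by auto

lemma graph_of_simps: "gverts (graph_of V E) = V" "gedges (graph_of V E) = (\<lambda>e. e \<inter> V) ` E"
  unfolding graph_of_def by simp_all

lemma reach_closed:
  assumes "(x, y) \<in> reach G" "x \<in> S" "\<And>a b. a \<in> S \<Longrightarrow> {a, b} \<in> gedges G \<Longrightarrow> b \<in> S"
  shows "y \<in> S"
proof -
  have "(x, y) \<in> {(x, y). {x, y} \<in> gedges G}\<^sup>*" using assms(1) unfolding reach_def by blast
  then show ?thesis using assms(2,3) by (induction rule: rtrancl_induct) auto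
qed

lemma graph_connected_closed:
  assumes "graph_connected G" "x \<in> gverts G" "x \<in> S" "\<And>a b. a \<in> S \<Longrightarrow> {a, b} \<in> gedges G \<Longrightarrow> b \<in> S"
  shows "gverts G \<subseteq> S"
proof
  fix y assume "y \<in> gverts G"
  then have "(x, y) \<in> reach G" using assms(1,2) unfolding graph_connected_def by blast
  then show "y \<in> S" using assms(3,4) by (rule reach_closed)
qed

lemma equiv_reach: "equiv (gverts G) (reach G)"
proof (rule equivI)
  show "reach G \<subseteq> gverts G \<times> gverts G" unfolding reach_def by blast
  show "refl_on (gverts G) (reach G)" unfolding reach_def refl_on_def by blast
  have "sym ({(x, y). {x, y} \<in> gedges G}\<^sup>*)"
    by (rule sym_rtrancl) (auto simp: sym_def insert_commute)
  then show "sym (reach G)" unfolding reach_def sym_def by blast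
  show "trans (reach G)" unfolding reach_def trans_def by (blast intro: rtrancl_trans)
qed

lemma reach_step:
  "(x, y) \<in> reach G \<Longrightarrow> {y, z} \<in> gedges G \<Longrightarrow> z \<in> gverts G \<Longrightarrow> (x, z) \<in> reach G"
  unfolding reach_def by (auto intro: rtrancl_into_rtrancl)

text \<open>Putting \<open>r\<close> back makes the graph connected. If \<open>r\<close> had no
  neighbour in the component of \<open>a\<close>, that component would stay closed under adjacency
  and thus contain every vertex, including \<open>b\<close>.\<close>

lemma minimal_cut_adjacent:
  assumes "minimal_cut G R" "\<And>e. e \<in> gedges G \<Longrightarrow> e \<subseteq> gverts G"
    and "a \<in> gverts G - R" "b \<in> gverts G - R" "(a, b) \<notin> reach (del_verts G R)" "r \<in> R"
  shows "\<exists>x. (a, x) \<in> reach (del_verts G R) \<and> {x, r} \<in> gedges G"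
proof (rule ccontr)
  assume no: "\<not> ?thesis"
  let ?S = "{x. (a, x) \<in> reach (del_verts G R)}"
  have conn: "graph_connected (del_verts G (R - {r}))"
    using assms(1,6) unfolding minimal_cut_def by blast
  have "gverts (del_verts G (R - {r})) \<subseteq> ?S"
  proof (rule graph_connected_closed[OF conn])
    show "a \<in> gverts (del_verts G (R - {r}))" using assms(3) unfolding del_verts_simps by blast
    show "a \<in> ?S" using equiv_class_self[OF equiv_reach, of a "del_verts G R"] assms(3)
      unfolding del_verts_simps by blast
    fix x y assume x: "x \<in> ?S" and xy: "{x, y} \<in> gedges (del_verts G (R - {r}))"
    have e: "{x, y} \<in> gedges G" "{x, y} \<subseteq> gverts G - (R - {r})" using xy unfolding del_verts_simps by blast+
    have xR: "x \<in> gverts G - R" using x unfolding reach_def del_verts_simps by blast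
    have "y \<noteq> r" using no x e(1) by blast
    then have y: "y \<in> gverts G - R" using e(2) by blast
    with e(1) xR have "{x, y} \<in> gedges (del_verts G R)" unfolding del_verts_simps by blast
    with x y show "y \<in> ?S" using reach_step[of a x "del_verts G R" y] unfolding del_verts_simps by blast
  qed
  then show False using assms(4,5) unfolding del_verts_simps by blast
qed

section \<open>Ear decomposition of a 2-connected plane graph\<close>

context plane_drawing
begin

lemma facial_subset: "facial X \<phi> \<Longrightarrow> X \<subseteq> E" "facial X \<phi> \<Longrightarrow> X \<noteq> {}"
  unfolding facial_def by (erule conjunct1, drule conjunct2, erule conjunct1)

context
  assumes biconnected: "k_vertex_connected 2 (graph_of V E)"
begin

lemma card_V: "card V > 2"
  using biconnected unfolding k_vertex_connected_def graph_of_simps by blast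

lemma connected_closed:
  assumes "card Z < 2" "Z \<subseteq> V" "x \<in> V - Z" "x \<in> S"
    "\<And>a b. a \<in> S \<Longrightarrow> {a, b} \<in> ends E \<Longrightarrow> {a, b} \<subseteq> V - Z \<Longrightarrow> b \<in> S"
  shows "V - Z \<subseteq> S"
proof -
  have "graph_connected (del_verts (graph_of V E) Z)"
    using biconnected assms(1,2) unfolding k_vertex_connected_def graph_of_simps by blast
  from graph_connected_closed[OF this, of x S] show ?thesis
    using assms(3-5) unfolding del_verts_simps graph_of_simps by blast
qed

text \<open>Connectivity excludes isolated vertices. The faces can then be taken in the complement
  of the edges alone, the form used for attaching ears.\<close>

lemma Union_E: "E \<noteq> {}" "V \<subseteq> \<Union>E"
proof -
  obtain v where v: "v \<in> V" using card_V by fastforce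
  show ne: "E \<noteq> {}"
  proof
    assume "E = {}"
    then have "V - {} \<subseteq> {v}" by (intro connected_closed[of "{}" v]) (use v in auto)
    then have "card V \<le> card {v}" by (intro card_mono) auto
    then show False using card_V by simp
  qed
  then obtain e where e: "e \<in> E" by blast
  obtain x y where xy: "e \<inter> V = {x, y}" "x \<noteq> y" by (rule edge_ends[OF e])
  have "V - {} \<subseteq> \<Union>E"
  proof (rule connected_closed[of "{}" x])
    show "x \<in> V - {}" "x \<in> \<Union>E" using xy(1) e by blast+
  qed auto
  then show "V \<subseteq> \<Union>E" by simp
qed

text \<open>If \<open>X\<close> already covers all vertices, any edge outside \<open>X\<close>
  serves. Otherwise connectivity yields an edge outside \<open>X\<close> that touches it.\<close>

lemma exists_leaving_edge:
  assumes X: "X \<subseteq> E" "X \<noteq> E" "X \<noteq> {}"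
  obtains e u v where "e \<in> E - X" "e \<inter> V = {u, v}" "u \<noteq> v" "u \<in> \<Union>X"
proof -
  have "\<exists>e \<in> E - X. e \<inter> V \<inter> \<Union>X \<noteq> {}"
  proof (cases "V \<subseteq> \<Union>X")
    case True
    obtain e where e: "e \<in> E - X" using X by blast
    then obtain x y where "e \<inter> V = {x, y}" using edge_ends[of e] by (metis DiffD1)
    then have "x \<in> e \<inter> V \<inter> \<Union>X" using True by blast
    then show ?thesis using e by blast
  next
    case False
    show ?thesis
    proof (rule ccontr)
      assume no: "\<not> ?thesis"
      obtain e where e: "e \<in> X" using X by blast
      then obtain x y where xy: "e \<inter> V = {x, y}" using edge_ends[of e] X by (metis subsetD)
      have "V - {} \<subseteq> \<Union>X"
      proof (rule connected_closed[of "{}" x])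
        show "x \<in> V - {}" "x \<in> \<Union>X" using xy e by blast+
        fix a b assume a: "a \<in> \<Union>X" "{a, b} \<in> ends E"
        then obtain e' where e': "e' \<in> E" "{a, b} = e' \<inter> V" by blast
        then have "a \<in> e' \<inter> V \<inter> \<Union>X" using a by blast
        then have "e' \<in> X" using no e'(1) by blast
        then show "b \<in> \<Union>X" using e'(2) by blast
      qed auto
      then show False using False by blast
    qed
  qed
  then obtain e u where eu: "e \<in> E - X" "u \<in> e \<inter> V" "u \<in> \<Union>X" by blast
  obtain x y where xy: "e \<inter> V = {x, y}" "x \<noteq> y" using edge_ends[of e] eu(1) by (metis DiffD1)
  then consider "u = x" | "u = y" using eu(2) by blast
  then show thesis
  proof cases
    case 1 then show thesis using that[of e x y] eu xy by blast
  next
    case 2 then show thesis using that[of e y x] eu xy by (metis insert_commute)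
  qed
qed

text \<open>An edge \<open>uv\<close> outside \<open>X\<close> starts the ear. Since deleting
  \<open>u\<close> leaves a connected graph, \<open>v\<close> can be continued to another vertex of
  \<open>X\<close> without returning to \<open>u\<close>; the ear ends at the first one met,
  possibly \<open>v\<close> itself.\<close>

lemma exists_ear:
  assumes X: "X \<subseteq> E" "X \<noteq> E" "X \<noteq> {}"
  shows "\<exists>u mid w. ear X u mid w"
proof -
  obtain e u v where e: "e \<in> E - X" "e \<inter> V = {u, v}" "u \<noteq> v" "u \<in> \<Union>X"
    using exists_leaving_edge[OF X] by metis
  have uv: "u \<in> V" "v \<in> V" "{u, v} \<in> ends (E - X)" using e by blast+
  let ?T = "V \<inter> \<Union>X - {u}"
  have "?T \<noteq> {}"
  proof -
    obtain e' where e': "e' \<in> X" using X by blast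
    obtain x y where xy: "e' \<inter> V = {x, y}" "x \<noteq> y" using edge_ends[of e'] e' X(1) by (metis subsetD)
    then have "x \<in> V \<inter> \<Union>X" "y \<in> V \<inter> \<Union>X" using e' by blast+
    then show ?thesis using xy(2) by blast
  qed
  then obtain z where z: "z \<in> ?T" by blast
  let ?A = "gedges (del_verts (graph_of V E) {u})"
  have A: "?A \<subseteq> ends E" "\<Union>?A \<subseteq> V - {u}"
    unfolding del_verts_simps graph_of_simps by blast+
  have "graph_connected (del_verts (graph_of V E) {u})"
    using biconnected uv(1) unfolding k_vertex_connected_def graph_of_simps by simp
  then have "(v, z) \<in> reach (del_verts (graph_of V E) {u})"
    using uv(2) e(3) z unfolding graph_connected_def del_verts_simps graph_of_simps by blast
  then have "(v, z) \<in> {(x, y). {x, y} \<in> ?A}\<^sup>*" unfolding reach_def by blast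
  then obtain xs w where xs: "distinct (xs @ [w])" "hd (xs @ [w]) = v" "set xs \<inter> ?T = {}" "w \<in> ?T"
    "path_edges (xs @ [w]) \<subseteq> ?A" by (rule exists_first_hitting_walk[OF _ z])
  have sub: "set xs \<subseteq> V - {u}"
  proof (cases xs)
    case (Cons a ys)
    then have "\<Union>(path_edges (xs @ [w])) = set (xs @ [w])" by (intro Union_path_edges) simp
    then have "set (xs @ [w]) \<subseteq> \<Union>?A" using Union_mono[OF xs(5)] by simp
    then show ?thesis using A(2) by auto
  qed simp
  have xsX: "set xs \<inter> \<Union>X = {}" using xs(3) sub by blast
  \<comment> \<open>Every edge of the walk has an end in \<open>xs\<close>, and no vertex of
    \<open>xs\<close> lies on \<open>X\<close>.\<close>
  have "path_edges (xs @ [w]) \<subseteq> ends (E - X)"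
  proof
    fix p assume p: "p \<in> path_edges (xs @ [w])"
    then obtain e' where e': "e' \<in> E" "p = e' \<inter> V" using xs(5) A(1) by blast
    obtain a b where ab: "p = {a, b}" "a \<noteq> b" "a \<in> set (xs @ [w])" "b \<in> set (xs @ [w])"
      using path_edgesE[OF p xs(1)] by metis
    then have "a \<in> set xs \<or> b \<in> set xs" by auto
    then have "p \<inter> set xs \<noteq> {}" using ab(1) by blast
    then have "e' \<notin> X" using xsX e'(2) by blast
    then show "p \<in> ends (E - X)" using e' by blast
  qed
  moreover have "path_edges (u # xs @ [w]) = insert {u, v} (path_edges (xs @ [w]))"
    using xs(2) by (cases xs) auto
  ultimately have "path_edges (u # xs @ [w]) \<subseteq> ends (E - X)" using uv(3) by simp
  moreover have "distinct (u # xs @ [w])" using xs(1,4) sub by auto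
  ultimately have "ear X u xs w"
    unfolding ear_def using xs(4) xsX uv(1) e(4) by blast
  then show ?thesis by blast
qed

text \<open>A maximal facial edge set exists, because an edge with an ear provides one to start
  from. It must be all of \<open>E\<close>, since otherwise an ear would enlarge it.\<close>

lemma exists_facial: "\<exists>\<phi>. facial E \<phi>"
proof -
  obtain e where e: "e \<in> E" using Union_E by blast
  have "E \<noteq> {e}"
  proof
    assume "E = {e}"
    then have "V = e \<inter> V" using Union_E(2) by blast
    moreover obtain x y where "e \<inter> V = {x, y}" "x \<noteq> y" by (rule edge_ends[OF e])
    ultimately have "card V = 2" by (metis card_2_iff)
    then show False using card_V by simp
  qed
  then obtain u mid w where "ear {e} u mid w" using exists_ear[of "{e}"] e by blast
  from facial_cycle[OF e this] have ne: "{X. \<exists>\<phi>. facial X \<phi>} \<noteq> {}" by blast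
  have sub: "{X. \<exists>\<phi>. facial X \<phi>} \<subseteq> Pow E" using facial_subset(1) by blast
  then have "finite {X. \<exists>\<phi>. facial X \<phi>}" using finite_VE(2) finite_subset by blast
  from finite_has_maximal[OF this ne] obtain X where X: "\<exists>\<phi>. facial X \<phi>"
    and max: "\<And>Y. \<exists>\<phi>. facial Y \<phi> \<Longrightarrow> X \<subseteq> Y \<Longrightarrow> X = Y" by blast
  obtain \<phi> where \<phi>: "facial X \<phi>" using X by blast
  have XE: "X \<subseteq> E" "X \<noteq> {}" using facial_subset[OF \<phi>] .
  have "X = E"
  proof (rule ccontr)
    assume "X \<noteq> E"
    then obtain u mid w where ear: "ear X u mid w" using exists_ear XE by blast
    have "X = X \<union> edges_on (u # mid @ [w])" by (rule max[OF facial_ear[OF \<phi> ear]]) blast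
    moreover have s: "path_edges (u # mid @ [w]) \<subseteq> ends (E - X)" using ear unfolding ear_def by blast
    moreover have "edges_on (u # mid @ [w]) \<inter> X = {}" by (rule edges_on_disjoint[OF s XE(1)])
    ultimately have "edges_on (u # mid @ [w]) = {}" by blast
    moreover have "path_edges (u # mid @ [w]) \<noteq> {}" by (cases mid) auto
    ultimately show False using s by blast
  qed
  then show ?thesis using X by simp
qed

lemma faces_eq: "faces V E = components (- \<Union>E)"
  using Union_E(2) unfolding faces_def by (simp add: Un_absorb1)

lemma facial_bounds_face:
  assumes fac: "facial E \<phi>" and F: "F \<in> faces V E"
  shows "bounds_face V E (\<phi> F) F"
proof -
  have \<phi>: "length (\<phi> F) \<ge> 3" "distinct (\<phi> F)" "path_edges (closed_walk (\<phi> F)) \<subseteq> ends E"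
    "frontier F = drawing (closed_walk (\<phi> F))"
    using bspec[OF fac[unfolded facial_def, THEN conjunct2, THEN conjunct2, THEN conjunct1]
        F[unfolded faces_eq]] by simp_all
  have cyc: "cycle_edges (\<phi> F) = path_edges (closed_walk (\<phi> F))"
    by (rule cycle_edges_eq_path_edges) (use \<phi>(1) in auto)
  have "\<Union>(path_edges (closed_walk (\<phi> F))) = set (closed_walk (\<phi> F))"
    by (rule Union_path_edges) (use \<phi>(1) in simp)
  then have "set (\<phi> F) \<subseteq> \<Union>(ends E)" using Union_mono[OF \<phi>(3)] by simp
  then have "set (\<phi> F) \<subseteq> V" by blast
  then show ?thesis
    unfolding bounds_face_def graph_cycle_def graph_of_simps cyc
    by (intro conjI \<phi>(1-3) \<phi>(4)[unfolded drawing_def])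
qed

end

end

section \<open>Parity of edges between two vertex sets, and the count\<close>

definition joins :: "'a set \<Rightarrow> 'a set \<Rightarrow> 'a \<Rightarrow> 'a \<Rightarrow> bool" where
  "joins A B x y \<longleftrightarrow> x \<in> A \<and> y \<in> B \<or> y \<in> A \<and> x \<in> B"

lemma symp_joins: "symp (joins A B)"
  unfolding joins_def by (rule sympI) blast

text \<open>Suppose a triangle has an edge from \<open>A\<close> to \<open>B\<close>. Its third
  vertex is adjacent to \<open>A\<close>, so it lies in \<open>A\<close> or in \<open>R\<close>; in
  the latter case it is adjacent to \<open>B\<close> within \<open>R\<close> and lies in
  \<open>B\<close>. Either way exactly two edges join \<open>A\<close> to \<open>B\<close>.\<close>

lemma not_odd_triangle:
  assumes "length vs = 3" "path_edges (closed_walk vs) \<subseteq> T" "A \<inter> R = {}" "B \<subseteq> R"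
    and "\<And>x y. {x, y} \<in> T \<Longrightarrow> x \<in> A \<Longrightarrow> y \<in> A \<or> y \<in> R"
    and "\<And>x y. {x, y} \<in> T \<Longrightarrow> x \<in> B \<Longrightarrow> y \<in> R \<Longrightarrow> y \<in> B"
  shows "\<not> odd_walk (joins A B) (closed_walk vs)"
proof -
  obtain x y z where vs: "vs = [x, y, z]"
    using assms(1) by (auto simp: numeral_3_eq_3 length_Suc_conv)
  have "{x, y} \<in> T" "{y, z} \<in> T" "{z, x} \<in> T" using assms(2) unfolding vs by auto
  then have T: "{x, y} \<in> T" "{y, x} \<in> T" "{y, z} \<in> T" "{z, y} \<in> T" "{z, x} \<in> T" "{x, z} \<in> T"
    by (simp_all add: insert_commute)
  note A = T[THEN assms(5)] and B = T[THEN assms(6)]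
  have "x \<in> A \<Longrightarrow> x \<notin> R" "y \<in> A \<Longrightarrow> y \<notin> R" "z \<in> A \<Longrightarrow> z \<notin> R"
    "x \<in> B \<Longrightarrow> x \<in> R" "y \<in> B \<Longrightarrow> y \<in> R" "z \<in> B \<Longrightarrow> z \<in> R" using assms(3,4) by blast+
  then show ?thesis
    unfolding vs joins_def append.simps list.sel odd_walk.simps using A B by argo
qed

text \<open>Classes are nonempty and pairwise disjoint, so a union of classes determines which of
  them occur.\<close>

lemma quotient_Union_eq:
  assumes "equiv S r" "I \<subseteq> S // r" "J \<subseteq> S // r" "\<Union>I = \<Union>J"
  shows "I = J"
proof -
  have "I \<subseteq> J" if IJ: "I \<subseteq> S // r" "J \<subseteq> S // r" "\<Union>I = \<Union>J" for I J
  proof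
    fix C assume C: "C \<in> I"
    then have "C \<noteq> {}" using in_quotient_imp_non_empty[OF assms(1)] IJ(1) by blast
    then obtain x where x: "x \<in> C" by blast
    then obtain D where D: "D \<in> J" "x \<in> D" using C IJ(3) by blast
    then have "C = D" using quotient_disj[OF assms(1), of C D] x C IJ(1,2) by blast
    then show "C \<in> J" using D by simp
  qed
  then show ?thesis using assms(2-4) by (metis subset_antisym)
qed

lemma card_le_if_inj_on_Pow:
  assumes "finite Q" "finite L" "q \<in> Q" "l \<in> L"
    "inj_on \<Psi> (Pow (Q - {q}))" "\<Psi> ` Pow (Q - {q}) \<subseteq> Pow (L - {l})"
  shows "card Q \<le> card L"
proof -
  have "card (Pow (Q - {q})) \<le> card (Pow (L - {l}))"
    by (rule card_inj_on_le[OF assms(5,6)]) (use assms(2) in simp)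
  then have "card (Q - {q}) \<le> card (L - {l})" using assms(1,2) by (simp add: card_Pow)
  then show ?thesis using assms(1-4) 
    by (simp add: card_Diff_singleton)
      (metis One_nat_def Suc_pred card_gt_0_iff empty_iff le_diff_conv Suc_eq_plus1)
qed

theorem theorem21:
  fixes V R :: "complex set" and E :: "complex set set" and k :: nat
  assumes "k \<ge> 1"
    and "plane_graph V E"
    and "k_vertex_connected 2 (graph_of V E)"
    and "card (large_faces V E) = k"
    and "minimal_cut (graph_of V E) R"
  shows "card (graph_components (induced (graph_of V E) R)) \<le> k"
proof -
  interpret plane_drawing V E using assms(2) by unfold_locales
  let ?G = "graph_of V E"
  let ?H = "del_verts ?G R" and ?I = "induced ?G R"
  let ?Q = "graph_components ?I"
  have RV: "R \<subseteq> V" and Rcut: "\<not> graph_connected ?H" "V - R \<noteq> {}"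
    using assms(5) unfolding minimal_cut_def is_cut_def graph_of_simps by blast+
  have vI: "gverts ?I = R" using RV unfolding induced_def graph_of_simps by auto
  have Q: "?Q = R // reach ?I" unfolding graph_components_def vI ..
  have eqv: "equiv R (reach ?I)" using equiv_reach[of ?I] unfolding vI .
  have finR: "finite R" using RV finite_VE(1) finite_subset by blast
  have finQ: "finite ?Q" unfolding Q using finR eqv
    by (meson equiv_type finite_quotient)
  show ?thesis
  proof (cases "?Q = {}")
    case True
    then show ?thesis by simp
  next
    case False
    then obtain C0 where C0: "C0 \<in> ?Q" by blast
    have finL: "finite (large_faces V E)"
      using assms(1,4) by (metis card.infinite not_one_le_zero)
    obtain F0 where F0: "F0 \<in> large_faces V E"
      using assms(1,4) by (metis card.empty equals0I not_one_le_zero)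
    \<comment> \<open>The graph left by the cut has vertices but is not connected, so two of them
      lie in different components, \<open>A\<close> and \<open>K\<close> below.\<close>
    obtain a b where ab: "a \<in> V - R" "b \<in> V - R" "(a, b) \<notin> reach ?H"
      using Rcut unfolding graph_connected_def del_verts_simps graph_of_simps by blast
    define A where "A = {x. (a, x) \<in> reach ?H}"
    define K where "K = {x. (b, x) \<in> reach ?H}"
    have sub: "e \<subseteq> gverts ?G" if "e \<in> gedges ?G" for e using that unfolding graph_of_simps by blast
    have symH: "sym (reach ?H)" and transH: "trans (reach ?H)"
      using equiv_reach[of ?H] by (auto elim: equivE)
    have AK: "A \<subseteq> V - R" "K \<subseteq> V - R" "a \<in> A" "b \<in> K" "A \<inter> K = {}"
    proof -
      show "A \<subseteq> V - R" "K \<subseteq> V - R"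
        unfolding A_def K_def reach_def del_verts_simps graph_of_simps by blast+
      show "a \<in> A" "b \<in> K" unfolding A_def K_def
        using equiv_class_self[OF equiv_reach, of _ ?H] ab unfolding del_verts_simps graph_of_simps by blast+
      show "A \<inter> K = {}"
        using ab(3) symD[OF symH] transD[OF transH] unfolding A_def K_def by blast
    qed
    have adjA: "\<exists>x\<in>A. {x, r} \<in> ends E" and adjK: "\<exists>x\<in>K. {x, r} \<in> ends E" if "r \<in> R" for r
    proof -
      have "(b, a) \<notin> reach ?H" using ab(3) symD[OF symH] by blast
      then show "\<exists>x\<in>A. {x, r} \<in> ends E" "\<exists>x\<in>K. {x, r} \<in> ends E"
        using minimal_cut_adjacent[OF assms(5) sub, of a b r]
          minimal_cut_adjacent[OF assms(5) sub, of b a r] ab that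
        unfolding A_def K_def graph_of_simps by blast+
    qed
    have stepA: "y \<in> A \<or> y \<in> R" if "{x, y} \<in> ends E" "x \<in> A" for x y
    proof -
      have y: "y \<in> V" using that(1) by blast
      show ?thesis
      proof (cases "y \<in> R")
        case False
        have "{x, y} \<subseteq> V - R" using False y AK(1) that(2) by blast
        then have "{x, y} \<in> gedges ?H" "y \<in> gverts ?H"
          using that(1) unfolding del_verts_simps graph_of_simps by blast+
        then show ?thesis using that(2) reach_step[of a x ?H y] unfolding A_def by blast
      qed simp
    qed
    \<comment> \<open>A function that does not change along edges inside a component of
      \<open>?H\<close> is constant on that component.\<close>
    have const: "f y = f z"
      if eqf: "\<And>x y. {x, y} \<in> ends E \<Longrightarrow> x \<in> S \<Longrightarrow> y \<in> S \<Longrightarrow> f x = f y"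
        and S: "S = {x. (c, x) \<in> reach ?H}" "y \<in> S" "z \<in> S" for f :: "complex \<Rightarrow> bool" and S c y z
    proof -
      have fc: "f x = f c" if x: "x \<in> S" for x
      proof -
        have "c \<in> gverts ?H" using x unfolding S(1) reach_def by blast
        then have cS: "c \<in> S" unfolding S(1) using equiv_class_self[OF equiv_reach, of c ?H] by blast
        have "x \<in> {x \<in> S. f x = f c}"
        proof (rule reach_closed)
          show "(c, x) \<in> reach ?H" using x S(1) by blast
          show "c \<in> {x \<in> S. f x = f c}" using cS by blast
          fix u v assume u: "u \<in> {x \<in> S. f x = f c}" and e: "{u, v} \<in> gedges ?H"
          have v: "v \<in> gverts ?H" and eE: "{u, v} \<in> ends E"
            using e unfolding del_verts_simps graph_of_simps by blast+
          have vS: "v \<in> S" using v u e reach_step[of c u ?H v] S(1) by blast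
          have "f u = f v" using u by (intro eqf[OF eE _ vS]) simp
          then show "v \<in> {x \<in> S. f x = f c}" using u vS by simp
        qed
        then show ?thesis by blast
      qed
      show ?thesis using fc[OF S(2)] fc[OF S(3)] by simp
    qed
    have QR: "\<Union>I \<subseteq> R" if "I \<subseteq> ?Q" for I
      using that Union_quotient[OF eqv] unfolding Q by blast
    have stepQ: "y \<in> \<Union>I" if st: "I \<subseteq> ?Q" "{x, y} \<in> ends E" "x \<in> \<Union>I" "y \<in> R" for I x y
    proof -
      obtain C where C: "C \<in> I" "x \<in> C" using st(3) by blast
      have xR: "x \<in> R" using QR[OF st(1)] st(3) by blast
      then have "{x, y} \<in> gedges ?I" using st(2,4) RV unfolding induced_def graph_of_simps by auto
      moreover have "(x, x) \<in> reach ?I" using eqv xR by (meson equivE refl_onD)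
      ultimately have "(x, y) \<in> reach ?I" using reach_step[of x x ?I y] st(4) vI by blast
      then have "y \<in> C" using in_quotient_imp_closed[OF eqv] C st(1) unfolding Q by blast
      then show ?thesis using C(1) by blast
    qed
    obtain \<phi> where \<phi>: "facial E \<phi>" using exists_facial[OF assms(3)] by blast
    define \<Psi> where "\<Psi> I = {F \<in> large_faces V E - {F0}. odd_walk (joins A (\<Union>I)) (closed_walk (\<phi> F))}" for I
    have "inj_on \<Psi> (Pow (?Q - {C0}))"
    proof (rule inj_onI)
      fix I J assume IJ: "I \<in> Pow (?Q - {C0})" "J \<in> Pow (?Q - {C0})" and eq: "\<Psi> I = \<Psi> J"
      have IJQ: "I \<subseteq> ?Q" "J \<subseteq> ?Q" using IJ by blast+
      \<comment> \<open>This is the symmetric difference of the two edge sets, whose parity along a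
        face is the sum of theirs. Equal images under \<open>\<Psi>\<close> make it even on all
        large faces but \<open>F0\<close>.\<close>
      define d where "d x y \<longleftrightarrow> joins A (\<Union>I) x y \<noteq> joins A (\<Union>J) x y" for x y
      have "symp d" using symp_joins[of A "\<Union>I"] symp_joins[of A "\<Union>J"]
        unfolding d_def symp_def by blast
      \<comment> \<open>A face that is not large is bounded by a triangle.\<close>
      have small: "\<not> odd_walk (joins A (\<Union>L)) (closed_walk (\<phi> F))"
        if F: "F \<in> faces V E - large_faces V E" and L: "L \<subseteq> ?Q" for F L
      proof -
        have bf: "bounds_face V E (\<phi> F) F" using facial_bounds_face[OF assms(3) \<phi>] F by blast
        have cyc: "length (\<phi> F) \<ge> 3" "cycle_edges (\<phi> F) \<subseteq> ends E"
          using bf unfolding bounds_face_def graph_cycle_def graph_of_simps by blast+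
        have "length (\<phi> F) < 4" using F bf unfolding large_faces_def
          by (metis (mono_tags, lifting) DiffE mem_Collect_eq not_less)
        then have len: "length (\<phi> F) = 3" using cyc(1) by simp
        have "cycle_edges (\<phi> F) = path_edges (closed_walk (\<phi> F))"
          by (rule cycle_edges_eq_path_edges) (use len in auto)
        then have pe: "path_edges (closed_walk (\<phi> F)) \<subseteq> ends E" using cyc(2) by simp
        show ?thesis
          by (rule not_odd_triangle[OF len pe _ QR[OF L] stepA stepQ[OF L]]) (use AK(1) in blast)+
      qed
      have even: "\<not> odd_walk d (closed_walk (\<phi> F))" if F: "F \<in> components (- \<Union>E) - {F0}" for F
      proof (cases "F \<in> large_faces V E")
        case True
        then have "F \<in> \<Psi> L \<longleftrightarrow> odd_walk (joins A (\<Union>L)) (closed_walk (\<phi> F))" for L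
          using F unfolding \<Psi>_def by blast
        then show ?thesis unfolding d_def odd_walk_xor using eq by blast
      next
        case False
        then have "F \<in> faces V E - large_faces V E" using F faces_eq[OF assms(3)] by blast
        from small[OF this IJQ(1)] small[OF this IJQ(2)]
        show ?thesis unfolding d_def odd_walk_xor by blast
      qed
      have "\<exists>f :: complex \<Rightarrow> bool. \<forall>x y. {x, y} \<in> ends E \<longrightarrow> (d x y \<longleftrightarrow> f x \<noteq> f y)"
        by (rule \<phi>[unfolded facial_def, THEN conjunct2, THEN conjunct2, THEN conjunct2, THEN spec,
              THEN spec, THEN mp, THEN mp, OF \<open>symp d\<close> ballI[OF even]])
      then obtain f :: "complex \<Rightarrow> bool" where
        f_all: "\<forall>x y. {x, y} \<in> ends E \<longrightarrow> (d x y \<longleftrightarrow> f x \<noteq> f y)" by (elim exE)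
      note f = f_all[rule_format]
      have IR: "\<Union>I \<subseteq> R" "\<Union>J \<subseteq> R" using QR IJQ by blast+
      have dA: "\<not> d x y" if "x \<in> A" "y \<in> A" for x y
        using that AK(1) IR unfolding d_def joins_def by blast
      have dK: "\<not> d x y" if "x \<in> K" for x y
        using that AK IR unfolding d_def joins_def by blast
      have dR: "d x r \<longleftrightarrow> (r \<in> \<Union>I) \<noteq> (r \<in> \<Union>J)" if "x \<in> A" "r \<in> R" for x r
        using that AK(1) IR unfolding d_def joins_def by blast
      have fA: "f x = f a" if "x \<in> A" for x
        by (rule const[OF _ A_def that AK(3)]) (use f dA in blast)
      have fK: "f x = f b" if "x \<in> K" for x
        by (rule const[OF _ K_def that AK(4)]) (use f dK in blast)
      \<comment> \<open>Each vertex of \<open>R\<close> is joined to \<open>K\<close>, and no edge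
        at \<open>K\<close> belongs to \<open>d\<close>, so the value on \<open>K\<close> spreads to
        \<open>R\<close>.\<close>
      have fR: "f r = f b" if r: "r \<in> R" for r
      proof -
        obtain x where "x \<in> K" "{x, r} \<in> ends E" using adjK[OF r] by blast
        then show ?thesis using f dK fK by metis
      qed
      \<comment> \<open>The right-hand side does not depend on \<open>r\<close>: the unions differ
        at all vertices of \<open>R\<close> or at none.\<close>
      have cr: "(r \<in> \<Union>I) \<noteq> (r \<in> \<Union>J) \<longleftrightarrow> f a \<noteq> f b" if r: "r \<in> R" for r
      proof -
        obtain x where x: "x \<in> A" "{x, r} \<in> ends E" using adjA[OF r] by blast
        then show ?thesis using f[OF x(2)] dR[OF x(1) r] fA[OF x(1)] fR[OF r] by simp
      qed
      \<comment> \<open>A vertex of the reserved component \<open>C0\<close> lies in neither union,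
        which decides for none.\<close>
      have "C0 \<noteq> {}" using C0 in_quotient_imp_non_empty[OF eqv] unfolding Q by blast
      then obtain r0 where r0: "r0 \<in> C0" by blast
      have r0n: "r0 \<notin> \<Union>L" if "L \<in> Pow (?Q - {C0})" for L
        using that r0 C0 quotient_disj[OF eqv, of C0] unfolding Q by blast
      have "r0 \<in> R" using r0 QR[of "{C0}"] C0 by blast
      then have "f a = f b" using cr r0n IJ by blast
      then have "\<Union>I = \<Union>J" using cr IR by blast
      then show "I = J" using quotient_Union_eq[OF eqv] IJQ unfolding Q by blast
    qed
    moreover have "\<Psi> ` Pow (?Q - {C0}) \<subseteq> Pow (large_faces V E - {F0})" unfolding \<Psi>_def by blast
    ultimately show ?thesis
      using card_le_if_inj_on_Pow[OF finQ finL C0 F0] assms(4) by blast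
  qed
qed

end
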